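(* Let $d\geq 3$ be a natural number. Let $(\mathbb{N},\mathcal{E})$ be a non-amenable coarse space of bounded geometry. Assume that there exists a highly computable symmetric entourage $E\in\mathcal{E}$ such that for every finite $F\subseteq\mathbb{N}$ we have $|E[F]|\geq (d+2)|F|$. Then there exists a computable $E'\in\mathcal{E}$ such that the graph $\Gamma(E')$ is a $d$-regular forest. Moreover, there exists an algorithm which, for any $m,n\in\mathbb{N}$, recognizes whether $m$ and $n$ are in the same connected component of $\Gamma(E')$.
   Context: For a relation $E\subseteq X\times X$, $x\in X$ and $A\subseteq X$, put $E[x]:=\{y\in X : (x,y)\in E\}$ and $E[A]:=\bigcup_{x\in A}E[x]$. A coarse space is a pair $(X,\mathcal{E})$ where $X$ is a set and $\mathcal{E}$ is a collection of subsets of $X\times X$ (called entourages) such that: the diagonal $\Delta_X\in\mathcal{E}$; if $F\subseteq E\in\mathcal{E}$ then $F\in\mathcal{E}$; if $E,F\in\mathcal{E}$ then $E\cup F,\ E^{-1},\ E\circ F\in\mathcal{E}$. It has bounded geometry if for each $E\in\mathcal{E}$ and every $x\in X$ the set $E[x]$ is finite. A coarse space $(X,\mathcal{E})$ of bounded geometry is amenable if for every $\theta>1$ and every $E\in\mathcal{E}$ there is a non-empty finite $F\subseteq X$ with $|E[F]|\leq\theta|F|$; otherwise it is non-amenable. For $E\subseteq \mathbb{N}\times\mathbb{N}$, $\Gamma(E)$ denotes the graph with vertex set $\mathbb{N}$ and edge relation $E$; when speaking of regularity, forests and connected components it is regarded as an undirected graph, $m$ and $n$ being adjacent iff $(m,n)\in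 E$ or $(n,m)\in E$. A $d$-regular forest is an acyclic graph in which every vertex has exactly $d$ neighbours. A relation $E\subseteq\mathbb{N}\times\mathbb{N}$ is computable if it is a computable set of pairs; a symmetric relation $E$ is highly computable if it is computable, every $E[n]$ is finite, and the function $n\mapsto |E[n]|$ is computable. *)

theory Defs
  imports Complex_Main
begin

section \<open>Coarse spaces\<close>

text \<open>
  For a relation \<open>E\<close> the sets written \<open>E[x]\<close> and \<open>E[A]\<close> are the relational images
  \<open>E `` {x}\<close> and \<open>E `` A\<close>.
\<close>

locale coarse_space =
  fixes X :: "'a set" and \<E> :: "('a \<times> 'a) set set"
  assumes entourage_subset: "E \<in> \<E> \<Longrightarrow> E \<subseteq> X \<times> X"
    and diagonal: "Id_on X \<in> \<E>"
    and subset_closed: "E \<in> \<E> \<Longrightarrow> F \<subseteq> E \<Longrightarrow> F \<in> \<E>"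
    and union_closed: "E \<in> \<E> \<Longrightarrow> F \<in> \<E> \<Longrightarrow> E \<union> F \<in> \<E>"
    and converse_closed: "E \<in> \<E> \<Longrightarrow> E\<inverse> \<in> \<E>"
    and relcomp_closed: "E \<in> \<E> \<Longrightarrow> F \<in> \<E> \<Longrightarrow> E O F \<in> \<E>"

locale bounded_geometry_coarse_space = coarse_space +
  assumes bounded_geometry: "E \<in> \<E> \<Longrightarrow> x \<in> X \<Longrightarrow> finite (E `` {x})"

definition amenable :: "'a set \<Rightarrow> ('a \<times> 'a) set set \<Rightarrow> bool" where
  "amenable X \<E> \<longleftrightarrow>
    (\<forall>\<theta>::real. \<theta> > 1 \<longrightarrow> (\<forall>E\<in>\<E>. \<exists>F. F \<subseteq> X \<and> F \<noteq> {} \<and> finite F \<and>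
      real (card (E `` F)) \<le> \<theta> * real (card F)))"


section \<open>The undirected graph of a relation\<close>

text \<open>The vertex set is the whole type \<open>'a\<close>.\<close>

definition adjacency :: "('a \<times> 'a) set \<Rightarrow> ('a \<times> 'a) set" where
  "adjacency E = E \<union> E\<inverse>"

text \<open>
  A cycle is listed without repeating its first vertex at the end. Length 1 is a loop; length 2
  is excluded, since it would traverse a single undirected edge back and forth.
\<close>

definition cycle :: "('a \<times> 'a) set \<Rightarrow> 'a list \<Rightarrow> bool" where
  "cycle E vs \<longleftrightarrow> vs \<noteq> [] \<and> length vs \<noteq> 2 \<and> distinct vs \<and>
    (\<forall>i<length vs. (vs ! i, vs ! (Suc i mod length vs)) \<in> adjacency E)"

definition regular_forest :: "nat \<Rightarrow> ('a \<times> 'a) set \<Rightarrow> bool" where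
  "regular_forest d E \<longleftrightarrow> (\<nexists>vs. cycle E vs) \<and>
    (\<forall>v. finite (adjacency E `` {v}) \<and> card (adjacency E `` {v}) = d)"

definition same_component :: "('a \<times> 'a) set \<Rightarrow> ('a \<times> 'a) set" where
  "same_component E = (adjacency E)\<^sup>*"


section \<open>Computability\<close>

text \<open>
  Programs for the partial recursive functions. They carry no arity: a program denotes one
  partial function on each \<open>nat\<^sup>k\<close>, and \<open>eval p xs y\<close> says that \<open>p\<close> halts on the
  argument tuple \<open>xs\<close> with value \<open>y\<close>. A projection or successor applied to a tuple that is too
  short diverges.
\<close>

datatype recf =
    Zero
  | Succ
  | Proj nat
  | Comp recf "recf list"
  | Prim_Rec recf recf
  | Mu recf

inductive eval :: "recf \<Rightarrow> nat list \<Rightarrow> nat \<Rightarrow> bool" where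
  eval_Zero: "eval Zero xs 0"
| eval_Succ: "eval Succ (x # xs) (Suc x)"
| eval_Proj: "i < length xs \<Longrightarrow> eval (Proj i) xs (xs ! i)"
| eval_Comp: "list_all2 (\<lambda>g y. eval g xs y) gs ys \<Longrightarrow> eval f ys z \<Longrightarrow> eval (Comp f gs) xs z"
| eval_Prim_Rec_0: "eval g xs y \<Longrightarrow> eval (Prim_Rec g h) (0 # xs) y"
| eval_Prim_Rec_Suc:
    "eval (Prim_Rec g h) (n # xs) y \<Longrightarrow> eval h (n # y # xs) z \<Longrightarrow>
      eval (Prim_Rec g h) (Suc n # xs) z"
| eval_Mu:
    "eval f (n # xs) 0 \<Longrightarrow> (\<And>m. m < n \<Longrightarrow> \<exists>y. eval f (m # xs) (Suc y)) \<Longrightarrow> eval (Mu f) xs n"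

inductive_cases eval_ZeroE: "eval Zero xs y"
inductive_cases eval_SuccE: "eval Succ xs y"
inductive_cases eval_ProjE: "eval (Proj i) xs y"
inductive_cases eval_CompE: "eval (Comp f gs) xs z"
inductive_cases eval_Prim_Rec_0E: "eval (Prim_Rec g h) (0 # xs) z"
inductive_cases eval_Prim_Rec_SucE: "eval (Prim_Rec g h) (Suc n # xs) z"
inductive_cases eval_MuE: "eval (Mu f) xs n"

lemma eval_deterministic: "eval p xs y \<Longrightarrow> eval p xs z \<Longrightarrow> y = z"
proof (induction p xs y arbitrary: z rule: eval.induct)
  case (eval_Comp xs gs ys f z z')
  from eval_Comp.prems obtain ys' where
    *: "list_all2 (\<lambda>g y. eval g xs y) gs ys'" "eval f ys' z'"
    by (rule eval_CompE)
  have "ys = ys'"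
    using eval_Comp.IH(1) *(1)
    by (auto simp: list_all2_conv_all_nth intro!: nth_equalityI)
  then show ?case using eval_Comp.IH(2) *(2) by blast
next
  case (eval_Prim_Rec_Suc g h n xs y z z')
  from eval_Prim_Rec_Suc.prems obtain y' where
    "eval (Prim_Rec g h) (n # xs) y'" "eval h (n # y' # xs) z'"
    by (rule eval_Prim_Rec_SucE)
  then show ?case using eval_Prim_Rec_Suc.IH by blast
next
  case (eval_Mu f n xs k)
  from eval_Mu.prems have *: "eval f (k # xs) 0" "\<And>m. m < k \<Longrightarrow> \<exists>y. eval f (m # xs) (Suc y)"
    by (blast elim: eval_MuE)+
  have "\<not> k < n" using eval_Mu.IH(2) *(1) by fastforce
  moreover have "\<not> n < k" using eval_Mu.IH(1) *(2) by fastforce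
  ultimately show ?case by simp
qed (blast elim: eval_ZeroE eval_SuccE eval_ProjE eval_Prim_Rec_0E)+

definition computable_fun :: "(nat \<Rightarrow> nat) \<Rightarrow> bool" where
  "computable_fun f \<longleftrightarrow> (\<exists>p. \<forall>n. eval p [n] (f n))"

definition computable_rel :: "(nat \<times> nat) set \<Rightarrow> bool" where
  "computable_rel R \<longleftrightarrow> (\<exists>p. \<forall>m n. eval p [m, n] (if (m, n) \<in> R then 1 else 0))"

definition highly_computable :: "(nat \<times> nat) set \<Rightarrow> bool" where
  "highly_computable E \<longleftrightarrow> computable_rel E \<and> (\<forall>n. finite (E `` {n})) \<and>
    computable_fun (\<lambda>n. card (E `` {n}))"

end

theory Submission
  imports Defs "HOL-Library.Nat_Bijection"
begin

text \<open>
  Enlarge \<open>E\<close> by the diagonal. Build in stages a map \<open>g\<close> with \<open>(g y, y) \<in> E\<close>, all of whose fibres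
  have exactly \<open>d + 1\<close> elements and each of whose orbits ends in a fixed point. A finite partial
  such map is good if the vertices without a fibre satisfy Hall's condition, with demand \<open>d + 1\<close>,
  relative to the vertices without a parent. Any vertex can be given a fibre while staying good: if
  it cannot become a fixed point itself, then it is a neighbour of a tight set, and the members of
  that set receive their fibres first. Because \<open>|E[F]| \<ge> (d + 2) |F|\<close>, a large set never violates
  Hall's condition after finitely many choices, and neither does a set far away from them, so
  goodness is decidable and a search for the next good extension computes \<open>g\<close>. Finally every vertex
  \<open>x\<close> that is not fixed abandons two of its \<open>d + 1\<close> children, and these two become adjacent to
  each other. This makes all degrees equal to \<open>d\<close>; every component has a root, which is found by
  following parents.
\<close>

section \<open>Computable functions of several variables\<close>

text \<open>The arguments of a function of \<open>k\<close> variables are the entries of a list; binders prepend the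
  bound variable, so that the variable number \<open>i\<close> is \<open>hd (tl (\<dots> xs))\<close> as with de Bruijn
  indices.\<close>

definition cmp :: "nat \<Rightarrow> (nat list \<Rightarrow> nat) \<Rightarrow> bool" where
  "cmp k f \<longleftrightarrow> (\<exists>p. \<forall>xs. length xs = k \<longrightarrow> eval p xs (f xs))"

abbreviation dec :: "nat \<Rightarrow> (nat list \<Rightarrow> bool) \<Rightarrow> bool" where
  "dec k P \<equiv> cmp k (\<lambda>xs. of_bool (P xs))"

text \<open>Only argument lists of length \<open>k\<close> matter. Hence the \<open>hd\<close>,
  \<open>tl\<close> and \<open>nth\<close> forms of the same variable can be exchanged, although
  they may differ on other lists.\<close>

lemma cmp_cong:
  assumes "cmp k f" "\<And>xs. length xs = k \<Longrightarrow> f xs = g xs"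
  shows "cmp k g"
proof -
  obtain p where "\<And>xs. length xs = k \<Longrightarrow> eval p xs (f xs)" using assms(1) by (auto simp: cmp_def)
  then have "eval p xs (g xs)" if "length xs = k" for xs using assms(2)[OF that] that by metis
  then show ?thesis unfolding cmp_def by blast
qed

lemma cmp_comp:
  assumes "cmp m f" "length gs = m" "\<And>g. g \<in> set gs \<Longrightarrow> cmp k g"
  shows "cmp k (\<lambda>xs. f (map (\<lambda>g. g xs) gs))"
proof -
  obtain p where p: "\<And>xs. length xs = m \<Longrightarrow> eval p xs (f xs)" using assms(1) by (auto simp: cmp_def)
  obtain q where q: "\<And>g xs. g \<in> set gs \<Longrightarrow> length xs = k \<Longrightarrow> eval (q g) xs (g xs)"
    using assms(3) unfolding cmp_def by metis
  have "eval (Comp p (map q gs)) xs (f (map (\<lambda>g. g xs) gs))" if "length xs = k" for xs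
    using p q that assms(2)
    by (intro eval_Comp[where ys = "map (\<lambda>g. g xs) gs"]) (auto simp: list_all2_conv_all_nth)
  then show ?thesis unfolding cmp_def by blast
qed

lemma cmp_nth: "i < k \<Longrightarrow> cmp k (\<lambda>xs. xs ! i)"
  unfolding cmp_def using eval_Proj by blast

lemma cmp_var0: "0 < k \<Longrightarrow> cmp k (\<lambda>xs. hd xs)"
  by (rule cmp_cong[OF cmp_nth[of 0]]) (auto simp: hd_conv_nth)

lemma hd_tl_funpow: "i < length xs \<Longrightarrow> hd ((tl ^^ i) xs) = xs ! i"
  by (induction i arbitrary: xs) (auto simp: hd_conv_nth funpow_Suc_right nth_tl simp del: funpow.simps(2))

lemma cmp_var: "i < k \<Longrightarrow> cmp k (\<lambda>xs. hd ((tl ^^ i) xs))"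
  by (rule cmp_cong[OF cmp_nth[of i]]) (auto simp: hd_tl_funpow)

lemma cmp_vars:
  "Suc 0 < k \<Longrightarrow> cmp k (\<lambda>xs. hd (tl xs))"
  "Suc (Suc 0) < k \<Longrightarrow> cmp k (\<lambda>xs. hd (tl (tl xs)))"
  "Suc (Suc (Suc 0)) < k \<Longrightarrow> cmp k (\<lambda>xs. hd (tl (tl (tl xs))))"
  "Suc (Suc (Suc (Suc 0))) < k \<Longrightarrow> cmp k (\<lambda>xs. hd (tl (tl (tl (tl xs)))))"
  "Suc (Suc (Suc (Suc (Suc 0)))) < k \<Longrightarrow> cmp k (\<lambda>xs. hd (tl (tl (tl (tl (tl xs))))))"
  by (drule cmp_var, simp)+

text \<open>Weakening: a function of the outer variables stays computable below a binder that
  prepends a new variable.\<close>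

lemma cmp_tl:
  assumes "cmp k f"
  shows "cmp (Suc k) (\<lambda>xs. f (tl xs))"
proof -
  let ?gs = "map (\<lambda>i xs. xs ! Suc i) [0..<k]"
  have "cmp (Suc k) (\<lambda>xs. f (map (\<lambda>g. g xs) ?gs))"
    using assms by (intro cmp_comp[of k]) (auto intro!: cmp_nth)
  then show ?thesis
  proof (rule cmp_cong)
    fix xs :: "nat list" assume "length xs = Suc k"
    then have "map (\<lambda>g. g xs) ?gs = tl xs" by (auto intro!: nth_equalityI simp: nth_tl)
    then show "f (map (\<lambda>g. g xs) ?gs) = f (tl xs)" by simp
  qed
qed

lemma cmp_app1:
  assumes "cmp 1 (\<lambda>xs. f (hd xs))" "cmp k a"
  shows "cmp k (\<lambda>xs. f (a xs))"
proof -
  have "cmp k (\<lambda>xs. (\<lambda>xs. f (hd xs)) (map (\<lambda>g. g xs) [a]))"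
    by (rule cmp_comp[OF assms(1)]) (use assms(2) in auto)
  then show ?thesis by simp
qed

lemma cmp_app2:
  assumes "cmp 2 (\<lambda>xs. f (hd xs) (hd (tl xs)))" "cmp k a" "cmp k b"
  shows "cmp k (\<lambda>xs. f (a xs) (b xs))"
proof -
  have "cmp k (\<lambda>xs. (\<lambda>xs. f (hd xs) (hd (tl xs))) (map (\<lambda>g. g xs) [a, b]))"
    by (rule cmp_comp[OF assms(1)]) (use assms(2,3) in auto)
  then show ?thesis by simp
qed

lemma cmp_Suc:
  assumes "cmp k a"
  shows "cmp k (\<lambda>xs. Suc (a xs))"
proof (rule cmp_app1[OF _ assms])
  have "eval Succ xs (Suc (hd xs))" if "length xs = 1" for xs
    using that by (cases xs) (auto intro: eval_Succ)
  then show "cmp 1 (\<lambda>xs. Suc (hd xs))" unfolding cmp_def by blast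
qed

lemma cmp_const: "cmp k (\<lambda>_. c)"
proof (induction c)
  case 0
  then show ?case unfolding cmp_def using eval_Zero by blast
next
  case (Suc c)
  then show ?case by (rule cmp_Suc)
qed

lemma cmp_rec:
  assumes a: "cmp k a" and b: "cmp k b"
    and h: "cmp (Suc (Suc k)) (\<lambda>ys. h (hd ys) (hd (tl ys)) (tl (tl ys)))"
  shows "cmp k (\<lambda>xs. rec_nat (a xs) (\<lambda>n y. h n y xs) (b xs))"
proof -
  obtain p where p: "\<And>xs. length xs = k \<Longrightarrow> eval p xs (a xs)" using a by (auto simp: cmp_def)
  obtain q where q: "\<And>n y xs. length xs = k \<Longrightarrow> eval q (n # y # xs) (h n y xs)"
    using h unfolding cmp_def by (metis length_Cons list.sel(1,3))
  have "eval (Prim_Rec p q) (n # xs) (rec_nat (a xs) (\<lambda>n y. h n y xs) n)" if "length xs = k" for n xs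
    by (induction n) (auto intro: p q that eval_Prim_Rec_0 eval_Prim_Rec_Suc)
  then have "eval (Prim_Rec p q) xs (rec_nat (a (tl xs)) (\<lambda>n y. h n y (tl xs)) (hd xs))"
    if "length xs = Suc k" for xs
    using that by (cases xs) auto
  then have r: "cmp (Suc k) (\<lambda>xs. rec_nat (a (tl xs)) (\<lambda>n y. h n y (tl xs)) (hd xs))"
    unfolding cmp_def by blast
  \<comment> \<open>Recursion runs on the first argument, so \<open>b\<close> is put in front of
    projections that copy the parameters.\<close>
  let ?gs = "b # map (\<lambda>i xs. xs ! i) [0..<k]"
  have "cmp k (\<lambda>xs. (\<lambda>xs. rec_nat (a (tl xs)) (\<lambda>n y. h n y (tl xs)) (hd xs)) (map (\<lambda>g. g xs) ?gs))"
    by (rule cmp_comp[OF r]) (auto intro: b cmp_nth)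
  then show ?thesis
  proof (rule cmp_cong)
    fix xs :: "nat list" assume "length xs = k"
    then have "map (\<lambda>g. g xs) (map (\<lambda>i xs. xs ! i) [0..<k]) = xs" by (auto intro!: nth_equalityI)
    then show "(\<lambda>xs. rec_nat (a (tl xs)) (\<lambda>n y. h n y (tl xs)) (hd xs)) (map (\<lambda>g. g xs) ?gs) =
        rec_nat (a xs) (\<lambda>n y. h n y xs) (b xs)" by simp
  qed
qed

section \<open>Arithmetic and bounded sums\<close>

lemma cmp_add:
  assumes "cmp k a" "cmp k b"
  shows "cmp k (\<lambda>xs. a xs + b xs)"
proof -
  have "cmp k (\<lambda>xs. rec_nat (a xs) (\<lambda>_ y. Suc y) (b xs))"
    using assms by (intro cmp_rec cmp_Suc cmp_vars) auto
  moreover have "rec_nat m (\<lambda>_ y. Suc y) n = m + n" for m n by (induction n) auto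
  ultimately show ?thesis by simp
qed

lemma cmp_sum:
  assumes "cmp k b" "cmp (Suc k) (\<lambda>ys. f (hd ys) (tl ys))"
  shows "cmp k (\<lambda>xs. \<Sum>i<b xs. f i xs)"
proof -
  let ?f = "\<lambda>ys. f (hd ys) (tl (tl ys))"
  \<comment> \<open>In the recursion step the second entry is the accumulated sum, which
    \<open>f\<close> must not see; these projections delete it.\<close>
  let ?gs = "hd # map (\<lambda>i xs. xs ! Suc (Suc i)) [0..<k]"
  have "cmp (Suc (Suc k)) (\<lambda>xs. (\<lambda>ys. f (hd ys) (tl ys)) (map (\<lambda>g. g xs) ?gs))"
    by (rule cmp_comp[OF assms(2)]) (auto intro: cmp_nth cmp_var0)
  then have "cmp (Suc (Suc k)) ?f"
  proof (rule cmp_cong)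
    fix xs :: "nat list" assume "length xs = Suc (Suc k)"
    then have "map (\<lambda>g. g xs) (map (\<lambda>i xs. xs ! Suc (Suc i)) [0..<k]) = tl (tl xs)"
      by (auto intro!: nth_equalityI simp: nth_tl)
    then show "(\<lambda>ys. f (hd ys) (tl ys)) (map (\<lambda>g. g xs) ?gs) = ?f xs" by simp
  qed
  then have "cmp k (\<lambda>xs. rec_nat 0 (\<lambda>i y. y + f i xs) (b xs))"
    using assms(1) by (intro cmp_rec cmp_add cmp_vars cmp_const) auto
  moreover have "rec_nat 0 (\<lambda>i y. y + f i xs) n = (\<Sum>i<n. f i xs)" for xs n
    by (induction n) auto
  ultimately show ?thesis by simp
qed

lemma cmp_mult:
  assumes "cmp k a" "cmp k b"
  shows "cmp k (\<lambda>xs. a xs * b xs)"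
proof -
  have "cmp k (\<lambda>xs. \<Sum>i<b xs. a xs)"
    by (rule cmp_sum[OF assms(2) cmp_tl[OF assms(1)]])
  then show ?thesis by (simp add: mult.commute)
qed

lemma cmp_diff:
  assumes "cmp k a" "cmp k b"
  shows "cmp k (\<lambda>xs. a xs - b xs)"
proof -
  have pred: "cmp k (\<lambda>xs. a xs - 1)" if "cmp k a" for k a
  proof -
    have "cmp k (\<lambda>xs. rec_nat 0 (\<lambda>n _. n) (a xs))"
      using that by (intro cmp_rec cmp_var0 cmp_const) auto
    moreover have "rec_nat 0 (\<lambda>n _. n) n = n - 1" for n :: nat by (cases n) auto
    ultimately show ?thesis by simp
  qed
  have "cmp k (\<lambda>xs. rec_nat (a xs) (\<lambda>_ y. y - 1) (b xs))"
    using assms by (intro cmp_rec pred cmp_vars) auto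
  moreover have "rec_nat m (\<lambda>_ y. y - 1) n = m - n" for m n :: nat by (induction n) auto
  ultimately show ?thesis by simp
qed

section \<open>Decidable predicates, bounded quantifiers and unbounded search\<close>

lemma dec_not:
  assumes "dec k P"
  shows "dec k (\<lambda>xs. \<not> P xs)"
  by (rule cmp_cong[OF cmp_diff[OF cmp_const[of k 1] assms]]) simp

lemma dec_conj:
  assumes "dec k P" "dec k Q"
  shows "dec k (\<lambda>xs. P xs \<and> Q xs)"
  by (rule cmp_cong[OF cmp_mult[OF assms]]) simp

lemma dec_disj:
  assumes "dec k P" "dec k Q"
  shows "dec k (\<lambda>xs. P xs \<or> Q xs)"
proof -
  have "dec k (\<lambda>xs. \<not> (\<not> P xs \<and> \<not> Q xs))"
    by (intro dec_not dec_conj assms)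
  then show ?thesis by simp
qed

lemma dec_imp:
  assumes "dec k P" "dec k Q"
  shows "dec k (\<lambda>xs. P xs \<longrightarrow> Q xs)"
  unfolding imp_conv_disj by (intro dec_not dec_disj assms)

text \<open>Subtraction on the naturals is truncated, so \<open>1 - (a - b)\<close> is the truth
  value of \<open>a \<le> b\<close>.\<close>

lemma dec_le:
  assumes "cmp k a" "cmp k b"
  shows "dec k (\<lambda>xs. a xs \<le> b xs)"
  by (rule cmp_cong[OF cmp_diff[OF cmp_const[of k 1] cmp_diff[OF assms]]]) simp

lemma dec_less:
  assumes "cmp k a" "cmp k b"
  shows "dec k (\<lambda>xs. a xs < b xs)"
  unfolding not_le[symmetric] by (intro dec_not dec_le assms)

lemma dec_eq:
  assumes "cmp k a" "cmp k b"
  shows "dec k (\<lambda>xs. a xs = b xs)"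
  unfolding order_eq_iff by (intro dec_conj dec_le assms)

lemma cmp_if:
  assumes "dec k P" "cmp k a" "cmp k b"
  shows "cmp k (\<lambda>xs. if P xs then a xs else b xs)"
proof (rule cmp_cong)
  show "cmp k (\<lambda>xs. of_bool (P xs) * a xs + of_bool (\<not> P xs) * b xs)"
    using assms by (intro cmp_add cmp_mult dec_not)
qed auto

lemma cmp_card:
  assumes "cmp k b" "dec (Suc k) (\<lambda>ys. P (hd ys) (tl ys))"
  shows "cmp k (\<lambda>xs. card {i. i < b xs \<and> P i xs})"
proof (rule cmp_cong[OF cmp_sum[OF assms]])
  fix xs :: "nat list"
  have "{..<b xs} \<inter> {i. P i xs} = {i. i < b xs \<and> P i xs}" by auto
  then show "(\<Sum>i<b xs. of_bool (P i xs)) = card {i. i < b xs \<and> P i xs}"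
    by (simp add: sum_of_bool_eq)
qed

lemma dec_ex:
  assumes "cmp k b" "dec (Suc k) (\<lambda>ys. P (hd ys) (tl ys))"
  shows "dec k (\<lambda>xs. \<exists>i<b xs. P i xs)"
proof (rule cmp_cong[OF dec_less[OF cmp_const[of k 0] cmp_card[OF assms]]])
  fix xs :: "nat list"
  have "0 < card {i. i < b xs \<and> P i xs} \<longleftrightarrow> (\<exists>i<b xs. P i xs)" by (auto simp: card_gt_0_iff)
  then show "of_bool (0 < card {i. i < b xs \<and> P i xs}) = (of_bool (\<exists>i<b xs. P i xs) :: nat)" by simp
qed

lemma dec_all:
  assumes "cmp k b" "dec (Suc k) (\<lambda>ys. P (hd ys) (tl ys))"
  shows "dec k (\<lambda>xs. \<forall>i<b xs. P i xs)"
proof -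
  have "dec k (\<lambda>xs. \<not> (\<exists>i<b xs. \<not> P i xs))"
    by (intro dec_not dec_ex assms)
  then show ?thesis by simp
qed

text \<open>\<open>Mu\<close> looks for a zero, so it is applied to a program for the negation of
  \<open>P\<close>. The values before the least witness are then positive, as \<open>eval_Mu\<close>
  requires, and the existence of a witness makes the search total.\<close>

lemma cmp_Least:
  assumes P: "dec (Suc k) (\<lambda>ys. P (hd ys) (tl ys))"
    and ex: "\<And>xs. length xs = k \<Longrightarrow> \<exists>n. P n xs"
  shows "cmp k (\<lambda>xs. LEAST n. P n xs)"
proof -
  obtain p where p: "\<And>n xs. length xs = k \<Longrightarrow> eval p (n # xs) (of_bool (\<not> P n xs))"
    using dec_not[OF P] unfolding cmp_def by (metis length_Cons list.sel(1,3))
  have "eval (Mu p) xs (LEAST n. P n xs)" if xs: "length xs = k" for xs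
  proof (rule eval_Mu)
    have "P (LEAST n. P n xs) xs" using ex[OF xs] by (rule LeastI_ex)
    then show "eval p ((LEAST n. P n xs) # xs) 0" using p[OF xs, of "LEAST n. P n xs"] by simp
  next
    fix m assume "m < (LEAST n. P n xs)"
    then have "\<not> P m xs" by (rule not_less_Least)
    then show "\<exists>y. eval p (m # xs) (Suc y)" using p[OF xs, of m] by auto
  qed
  then show ?thesis unfolding cmp_def by blast
qed

section \<open>Iteration, division and the coding of pairs and finite sets\<close>

lemma cmp_funpow:
  assumes "cmp 1 (\<lambda>xs. f (hd xs))" "cmp k a" "cmp k b"
  shows "cmp k (\<lambda>xs. (f ^^ a xs) (b xs))"
proof -
  have "cmp k (\<lambda>xs. rec_nat (b xs) (\<lambda>_ y. f y) (a xs))"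
    using assms by (intro cmp_rec cmp_app1[OF assms(1)] cmp_vars) auto
  moreover have "rec_nat m (\<lambda>_ y. f y) n = (f ^^ n) m" for m n by (induction n) auto
  ultimately show ?thesis by simp
qed

lemma cmp_power2: "cmp k a \<Longrightarrow> cmp k (\<lambda>xs. 2 ^ a xs)"
proof -
  assume "cmp k a"
  then have "cmp k (\<lambda>xs. rec_nat 1 (\<lambda>_ y. 2 * y) (a xs))"
    by (intro cmp_rec cmp_mult cmp_const cmp_vars) auto
  moreover have "rec_nat 1 (\<lambda>_ y. 2 * y) n = (2::nat) ^ n" for n by (induction n) auto
  ultimately show ?thesis by simp
qed

text \<open>The quotient is the least \<open>q\<close> with \<open>a < (q + 1) * b\<close>. The
  alternative \<open>b = 0\<close> keeps the search total and returns 0, which is also the value of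
  division by 0.\<close>

lemma cmp_div:
  assumes "cmp k a" "cmp k b"
  shows "cmp k (\<lambda>xs. a xs div b xs)"
proof -
  have "cmp k (\<lambda>xs. LEAST q. b xs = 0 \<or> a xs < Suc q * b xs)"
  proof (rule cmp_Least)
    show "dec (Suc k) (\<lambda>ys. b (tl ys) = 0 \<or> a (tl ys) < Suc (hd ys) * b (tl ys))"
      using assms[THEN cmp_tl]
      by (intro dec_disj dec_eq dec_less cmp_mult cmp_Suc cmp_var0 cmp_const) auto
    show "\<exists>q. b xs = 0 \<or> a xs < Suc q * b xs" for xs
      by (metis div_less_iff_less_mult lessI neq0_conv)
  qed
  moreover have "(LEAST q. n = 0 \<or> m < Suc q * n) = m div n" for m n :: nat
  proof (cases "n = 0")
    case False
    then have "n = 0 \<or> m < Suc q * n \<longleftrightarrow> m div n \<le> q" for q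
      using div_less_iff_less_mult[of n m "Suc q"] by (auto simp del: mult_Suc)
    then show ?thesis by (simp add: Least_equality)
  qed (simp add: Least_eq_0)
  ultimately show ?thesis by simp
qed

lemma cmp_prod_encode:
  assumes "cmp k a" "cmp k b"
  shows "cmp k (\<lambda>xs. prod_encode (a xs, b xs))"
  unfolding prod_encode_def triangle_def prod.case
  by (intro cmp_add cmp_mult cmp_div cmp_const cmp_Suc assms)

lemma dec_set_decode:
  assumes "cmp k a" "cmp k b"
  shows "dec k (\<lambda>xs. a xs \<in> set_decode (b xs))"
proof (rule cmp_cong)
  let ?q = "\<lambda>xs. b xs div 2 ^ a xs"
  show "dec k (\<lambda>xs. ?q xs = Suc (2 * (?q xs div 2)))"
    using assms by (intro dec_eq cmp_Suc cmp_mult cmp_div cmp_power2 cmp_const)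
  have "n = Suc (2 * (n div 2)) \<longleftrightarrow> odd n" for n :: nat by presburger
  then show "of_bool (?q xs = Suc (2 * (?q xs div 2))) = (of_bool (a xs \<in> set_decode (b xs)) :: nat)"
    for xs by (simp add: set_decode_def)
qed

lemmas cmp_intros = cmp_var0 cmp_vars cmp_const cmp_Suc cmp_add cmp_mult cmp_diff cmp_div
  cmp_power2 cmp_prod_encode cmp_if cmp_card cmp_sum
  dec_not dec_conj dec_disj dec_imp dec_le dec_less dec_eq dec_ex dec_all dec_set_decode

lemma computable_fun_iff_cmp: "computable_fun f \<longleftrightarrow> cmp 1 (\<lambda>xs. f (hd xs))"
proof -
  have "(\<forall>n. eval p [n] (f n)) \<longleftrightarrow> (\<forall>xs. length xs = 1 \<longrightarrow> eval p xs (f (hd xs)))" for p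
    by (auto simp: length_Suc_conv)
  then show ?thesis by (simp add: computable_fun_def cmp_def)
qed

lemma computable_rel_iff_dec: "computable_rel R \<longleftrightarrow> dec 2 (\<lambda>xs. (hd xs, hd (tl xs)) \<in> R)"
proof -
  have "(\<forall>m n. eval p [m, n] (if (m, n) \<in> R then 1 else 0)) \<longleftrightarrow>
    (\<forall>xs. length xs = 2 \<longrightarrow> eval p xs (of_bool ((hd xs, hd (tl xs)) \<in> R)))" for p
    by (auto simp: length_Suc_conv numeral_2_eq_2 of_bool_def)
  then show ?thesis by (simp add: computable_rel_def cmp_def)
qed

section \<open>Hall's condition with demands\<close>

locale locally_finite_relation =
  fixes E :: "('a \<times> 'a) set"
  assumes finite_Image: "finite (E `` {x})"
begin

lemma finite_Image_finite: "finite F \<Longrightarrow> finite (E `` F)"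
proof -
  assume "finite F"
  moreover have "E `` F = (\<Union>x\<in>F. E `` {x})" by blast
  ultimately show ?thesis using finite_Image by simp
qed

text \<open>\<open>X\<close> is the set of vertices that are no longer available, \<open>w x\<close> the number of neighbours that
  \<open>x\<close> still has to receive.\<close>

definition hall :: "'a set \<Rightarrow> ('a \<Rightarrow> nat) \<Rightarrow> bool" where
  "hall X w \<longleftrightarrow> (\<forall>F. finite F \<longrightarrow> sum w F \<le> card (E `` F - X))"

text \<open>The available neighbours of such a set just cover its demand, so giving one of them to
  an outside vertex would violate Hall's condition.\<close>

definition tight :: "'a set \<Rightarrow> ('a \<Rightarrow> nat) \<Rightarrow> 'a set \<Rightarrow> bool" where
  "tight X w T \<longleftrightarrow> finite T \<and> card (E `` T - X) = sum w T"

text \<open>Demand is modular and the number of available neighbours is submodular. Hall's condition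
  for the union and the intersection forces equality everywhere, and equal cardinalities in an
  inclusion of neighbourhoods give the last claim.\<close>

lemma tight_Un_Int:
  assumes h: "hall X w" and S: "tight X w S" and T: "tight X w T"
  shows "tight X w (S \<union> T)" "tight X w (S \<inter> T)"
    "(E `` S - X) \<inter> (E `` T - X) = E `` (S \<inter> T) - X"
proof -
  let ?N = "\<lambda>F. E `` F - X"
  have fin: "finite S" "finite T" "finite (?N S)" "finite (?N T)"
    using S T finite_Image_finite by (auto simp: tight_def)
  have sub: "?N (S \<inter> T) \<subseteq> ?N S \<inter> ?N T" by blast
  have un: "?N (S \<union> T) = ?N S \<union> ?N T" by blast
  have "card (?N S) + card (?N T) = card (?N (S \<union> T)) + card (?N S \<inter> ?N T)"
    unfolding un using fin by (intro card_Un_Int)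
  moreover have "sum w S + sum w T = sum w (S \<union> T) + sum w (S \<inter> T)"
    using fin by (simp add: sum.union_inter)
  moreover have "card (?N S) = sum w S" "card (?N T) = sum w T"
    using S T by (auto simp: tight_def)
  moreover have "sum w (S \<union> T) \<le> card (?N (S \<union> T))" "sum w (S \<inter> T) \<le> card (?N (S \<inter> T))"
    using h fin by (auto simp: hall_def)
  moreover have "card (?N (S \<inter> T)) \<le> card (?N S \<inter> ?N T)"
    using sub fin by (intro card_mono) auto
  ultimately have eqs: "card (?N (S \<union> T)) = sum w (S \<union> T)" "card (?N (S \<inter> T)) = sum w (S \<inter> T)"
    "card (?N (S \<inter> T)) = card (?N S \<inter> ?N T)"
    by linarith+
  then show "tight X w (S \<union> T)" "tight X w (S \<inter> T)"
    using fin by (auto simp: tight_def)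
  show "(E `` S - X) \<inter> (E `` T - X) = E `` (S \<inter> T) - X"
    using sub fin eqs(3) by (metis card_subset_eq finite_Int)
qed

lemma tight_UN:
  assumes "hall X w" "finite I" "\<And>i. i \<in> I \<Longrightarrow> tight X w (T i)"
  shows "tight X w (\<Union>i\<in>I. T i)"
  using assms(2,3)
proof (induction I rule: finite_induct)
  case empty
  then show ?case by (simp add: tight_def)
next
  case (insert i I)
  then show ?case using tight_Un_Int(1)[OF assms(1)] by simp
qed

text \<open>Assigning \<open>y\<close> to \<open>z\<close> lowers the demand of every set containing
  \<open>z\<close> by one, which pays for the loss of \<open>y\<close>. A set without
  \<open>z\<close> suffers only if it has \<open>y\<close> as a neighbour and no slack, that is, if
  it is tight.\<close>

lemma hall_assign_or_tight:
  assumes h: "hall X w" and y: "y \<in> E `` {z} - X" and z: "0 < w z"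
  shows "hall (insert y X) (w(z := w z - 1)) \<or>
    (\<exists>T. tight X w T \<and> z \<notin> T \<and> y \<in> E `` T)"
proof (rule disjCI)
  assume no: "\<nexists>T. tight X w T \<and> z \<notin> T \<and> y \<in> E `` T"
  show "hall (insert y X) (w(z := w z - 1))"
    unfolding hall_def
  proof (intro allI impI)
    fix F :: "'a set" assume F: "finite F"
    have fin: "finite (E `` F - X)" using F finite_Image_finite by blast
    have le: "sum w F \<le> card (E `` F - X)" using h F by (auto simp: hall_def)
    have eq: "E `` F - insert y X = (E `` F - X) - {y}" by blast
    show "sum (w(z := w z - 1)) F \<le> card (E `` F - insert y X)"
    proof (cases "z \<in> F")
      case True
      have "sum (w(z := w z - 1)) (F - {z}) = sum w (F - {z})" by (intro sum.cong) auto
      then have "sum (w(z := w z - 1)) F = sum w F - 1"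
        using True F z by (simp add: sum.remove)
      moreover have "card (E `` F - X) - 1 \<le> card (E `` F - insert y X)"
        unfolding eq by (simp add: card_Diff_singleton_if)
      ultimately show ?thesis using le by linarith
    next
      case False
      then have "sum (w(z := w z - 1)) F = sum w F" by (intro sum.cong) auto
      moreover have "sum w F \<le> card (E `` F - insert y X)"
      proof (cases "y \<in> E `` F")
        case True
        then have "card (E `` F - X) \<noteq> sum w F" using no False F unfolding tight_def by blast
        then show ?thesis unfolding eq using le by (auto simp: card_Diff_singleton_if)
      next
        case False
        then show ?thesis unfolding eq using le by simp
      qed
      ultimately show ?thesis by simp
    qed
  qed
qed

text \<open>If every available neighbour of \<open>z\<close> were blocked by a tight set avoiding
  \<open>z\<close>, the union \<open>U\<close> of these finitely many sets would be tight and would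
  have all of them as neighbours. Adding \<open>z\<close> to \<open>U\<close> would then raise the
  demand without adding available neighbours.\<close>

lemma hall_assign_one:
  assumes h: "hall X w" and z: "0 < w z"
  obtains y where "y \<in> E `` {z} - X" "hall (insert y X) (w(z := w z - 1))"
proof (rule ccontr)
  assume "\<not> thesis"
  then have "\<forall>y\<in>E `` {z} - X. \<exists>T. tight X w T \<and> z \<notin> T \<and> y \<in> E `` T"
    using that hall_assign_or_tight[OF h _ z] by blast
  then obtain T where T: "\<And>y. y \<in> E `` {z} - X \<Longrightarrow> tight X w (T y) \<and> z \<notin> T y \<and> y \<in> E `` T y"
    by metis
  define U where "U = (\<Union>y\<in>E `` {z} - X. T y)"
  have U: "tight X w U" "z \<notin> U" "E `` {z} - X \<subseteq> E `` U"
  proof -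
    show "tight X w U" unfolding U_def using T finite_Image by (intro tight_UN[OF h]) auto
    show "z \<notin> U" unfolding U_def using T by blast
    show "E `` {z} - X \<subseteq> E `` U" unfolding U_def using T by blast
  qed
  have "E `` insert z U - X = E `` U - X" using U(3) by blast
  then have "card (E `` insert z U - X) = sum w U" using U(1) by (simp add: tight_def)
  moreover have "sum w (insert z U) = w z + sum w U" using U by (simp add: tight_def)
  moreover have "sum w (insert z U) \<le> card (E `` insert z U - X)"
    using h U(1) by (simp add: hall_def tight_def)
  ultimately show False using z by simp
qed

lemma hall_assign:
  assumes "hall X w"
  obtains D where "D \<subseteq> E `` {z} - X" "card D = w z" "hall (X \<union> D) (w(z := 0))"
proof -
  have "\<exists>D. D \<subseteq> E `` {z} - X \<and> card D = w z \<and> hall (X \<union> D) (w(z := 0))"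
    using assms
  proof (induction "w z" arbitrary: w X)
    case 0
    then have "w(z := 0) = w" by auto
    with 0 show ?case by (intro exI[of _ "{}"]) simp
  next
    case (Suc n)
    from Suc.hyps(2) have "0 < w z" by simp
    then obtain y where y: "y \<in> E `` {z} - X" "hall (insert y X) (w(z := w z - 1))"
      using hall_assign_one[OF Suc.prems] by blast
    have "n = (w(z := w z - 1)) z" using Suc.hyps(2) by simp
    from Suc.hyps(1)[OF this y(2)] this obtain D where
      D: "D \<subseteq> E `` {z} - insert y X" "card D = n" "hall (insert y X \<union> D) (w(z := 0))"
      by auto
    have "finite D" using D(1) finite_Image by (meson finite_Diff finite_subset)
    moreover have "y \<notin> D" using D(1) by blast
    ultimately have "card (insert y D) = w z" using D(2) Suc.hyps(2) by simp
    then show ?case using D y by (intro exI[of _ "insert y D"]) auto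
  qed
  then show thesis using that by blast
qed

end

section \<open>Finite partial assignments\<close>

locale expanding_relation = locally_finite_relation E for E :: "('a \<times> 'a) set" +
  fixes K :: nat
  assumes refl_E: "(x, x) \<in> E" and sym_E: "sym E" and K_pos: "0 < K"
    and expanding: "finite F \<Longrightarrow> Suc K * card F \<le> card (E `` F)"

text \<open>A triple \<open>(y, z, t)\<close> assigns the parent \<open>z\<close> to \<open>y\<close>; the rank \<open>t\<close> certifies that iterating
  the parent map ends in a fixed point.\<close>

definition claimed :: "('a \<times> 'a \<times> nat) set \<Rightarrow> 'a set" where
  "claimed S = {y. \<exists>z t. (y, z, t) \<in> S}"

definition parents :: "('a \<times> 'a \<times> nat) set \<Rightarrow> 'a set" where
  "parents S = {z. \<exists>y t. (y, z, t) \<in> S}"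

definition fibre :: "('a \<times> 'a \<times> nat) set \<Rightarrow> 'a \<Rightarrow> 'a set" where
  "fibre S z = {y. \<exists>t. (y, z, t) \<in> S}"

context expanding_relation
begin

text \<open>Fibres are assigned as a whole, so a demand is either untouched or fully met.\<close>

definition demand :: "'a set \<Rightarrow> 'a \<Rightarrow> nat" where
  "demand P x = (if x \<in> P then 0 else K)"

text \<open>By the last clause a triple either records a fixed point, or its parent has a triple of
  smaller rank. In both cases the parent is claimed, so chains of parents stay inside
  \<open>S\<close>.\<close>

definition valid :: "('a \<times> 'a \<times> nat) set \<Rightarrow> bool" where
  "valid S \<longleftrightarrow>
    (\<forall>y z t z' t'. (y, z, t) \<in> S \<longrightarrow> (y, z', t') \<in> S \<longrightarrow> z = z' \<and> t = t') \<and>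
    (\<forall>y z t. (y, z, t) \<in> S \<longrightarrow>
      (z, y) \<in> E \<and> card (fibre S z) = K \<and> (y = z \<or> (\<exists>z' t'. t' < t \<and> (z, z', t') \<in> S)))"

definition good :: "('a \<times> 'a \<times> nat) set \<Rightarrow> bool" where
  "good S \<longleftrightarrow> finite S \<and> valid S \<and> hall (claimed S) (demand (parents S))"

section \<open>Extending a good partial assignment\<close>

lemma good_empty: "good {}"
proof -
  have "sum (demand {}) F \<le> card (E `` F)" if "finite F" for F :: "'a set"
    using expanding[OF that] by (simp add: demand_def algebra_simps)
  then show ?thesis by (simp add: good_def valid_def claimed_def parents_def hall_def)
qed

lemma parents_subset_claimed: "good S \<Longrightarrow> parents S \<subseteq> claimed S"
  unfolding good_def valid_def parents_def claimed_def by blast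

text \<open>A parent has to be claimed itself. If \<open>z\<close> is not yet claimed it therefore
  becomes its own child, and \<open>free\<close> says that no tight set forbids this.\<close>

lemma good_extend:
  assumes S: "good S" and z: "z \<notin> parents S"
    and free: "z \<in> claimed S \<or>
      (\<nexists>T. tight (claimed S) (demand (parents S)) T \<and> z \<notin> T \<and> z \<in> E `` T)"
  obtains S' D where "good S'" "S \<subseteq> S'" "claimed S' = claimed S \<union> D"
    "parents S' = insert z (parents S)" "D \<subseteq> E `` {z} - claimed S" "card D = K"
proof -
  let ?X = "claimed S" and ?w = "demand (parents S)"
  have h: "hall ?X ?w" and v: "valid S" and finS: "finite S" using S by (auto simp: good_def)
  have wz: "?w z = K" using z by (simp add: demand_def)
  have w0: "?w(z := 0) = demand (insert z (parents S))" by (auto simp: demand_def)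
  obtain D where D: "D \<subseteq> E `` {z} - ?X" "card D = K" "z \<in> ?X \<or> z \<in> D"
    "hall (?X \<union> D) (demand (insert z (parents S)))"
  proof (cases "z \<in> ?X")
    case True
    obtain D where "D \<subseteq> E `` {z} - ?X" "card D = ?w z" "hall (?X \<union> D) (?w(z := 0))"
      using hall_assign[OF h] .
    then show thesis using True wz by (intro that) (simp_all add: w0)
  next
    case False
    then have "z \<in> E `` {z} - ?X" using refl_E by blast
    \<comment> \<open>First \<open>z\<close> is assigned to itself; the remaining
      \<open>K - 1\<close> children then come from the general assignment.\<close>
    then have h': "hall (insert z ?X) (?w(z := ?w z - 1))"
      using hall_assign_or_tight[OF h, of z z] free False wz K_pos by auto
    obtain D where D: "D \<subseteq> E `` {z} - insert z ?X" "card D = K - 1"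
      "hall (insert z ?X \<union> D) (demand (insert z (parents S)))"
      using hall_assign[OF h', of z] by (simp add: wz w0) metis
    have "finite D" using D(1) finite_Image by (meson finite_Diff finite_subset)
    moreover have "z \<notin> D" using D(1) by blast
    ultimately have "card (insert z D) = K" using D(2) K_pos by simp
    then show thesis using D False refl_E by (intro that[of "insert z D"]) auto
  qed
  obtain t0 where t0: "z \<in> ?X \<Longrightarrow> \<exists>z'. (z, z', t0) \<in> S" "z \<notin> ?X \<Longrightarrow> t0 = 0"
    by (cases "z \<in> ?X") (auto simp: claimed_def)
  \<comment> \<open>The children rank just above \<open>z\<close>, whose own rank is
    \<open>t0\<close>. If \<open>z\<close> becomes a fixed point, it gets rank 0 and the other
    children rank 1.\<close>
  define R where "R = (\<lambda>y. (y, z, if y = z then 0 else Suc t0)) ` D"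
  have finD: "finite D" using D(2) K_pos card_ge_0_finite by metis
  have D_ne: "D \<noteq> {}" using D(2) K_pos by auto
  have cl: "claimed (S \<union> R) = ?X \<union> D" by (auto simp: claimed_def R_def)
  have par: "parents (S \<union> R) = insert z (parents S)" using D_ne by (auto simp: parents_def R_def)
  have fib: "fibre (S \<union> R) x = (if x = z then D else fibre S x)" for x
    using z by (auto simp: fibre_def R_def parents_def)
  have "valid (S \<union> R)"
    unfolding valid_def
  proof (rule conjI; intro allI impI)
    fix y x t x' t' assume "(y, x, t) \<in> S \<union> R" "(y, x', t') \<in> S \<union> R"
    then consider "(y, x, t) \<in> S" "(y, x', t') \<in> S" | "(y, x, t) \<in> R" "(y, x', t') \<in> R"
      | "(y, x, t) \<in> S" "(y, x', t') \<in> R" | "(y, x, t) \<in> R" "(y, x', t') \<in> S"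
      by blast
    then show "x = x' \<and> t = t'"
    proof cases
      case 1
      then show ?thesis using v unfolding valid_def by blast
    qed (use D(1) in \<open>auto simp: R_def claimed_def\<close>)
  next
    fix y x t assume "(y, x, t) \<in> S \<union> R"
    then consider (S) "(y, x, t) \<in> S" | (R) "(y, x, t) \<in> R" by blast
    then show "(x, y) \<in> E \<and> card (fibre (S \<union> R) x) = K \<and>
      (y = x \<or> (\<exists>z' t'. t' < t \<and> (x, z', t') \<in> S \<union> R))"
    proof cases
      case S
      then have "x \<noteq> z" using z by (auto simp: parents_def)
      moreover have "(x, y) \<in> E \<and> card (fibre S x) = K \<and> (y = x \<or> (\<exists>z' t'. t' < t \<and> (x, z', t') \<in> S))"
        using v S unfolding valid_def by blast
      ultimately show ?thesis unfolding fib by auto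
    next
      case R
      then have x: "x = z" "y \<in> D" "t = (if y = z then 0 else Suc t0)" by (auto simp: R_def)
      have "\<exists>z' t'. t' < t \<and> (x, z', t') \<in> S \<union> R" if "y \<noteq> z"
      proof (cases "z \<in> ?X")
        case True
        then show ?thesis using t0 x that by auto
      next
        case False
        then have "(z, z, 0) \<in> R" using D(3) by (auto simp: R_def)
        then show ?thesis using x that by auto
      qed
      then show ?thesis using D x fib by auto
    qed
  qed
  then have "good (S \<union> R)"
    using D(4) finS finD unfolding good_def cl par by (simp add: R_def)
  then show thesis using that[of "S \<union> R" D] cl par D by blast
qed

text \<open>Since the relation is reflexive, a vertex of a minimal tight set that is not claimed yet is
  not needed by any other tight set, so that it can safely become a fixed point.\<close>

lemma good_claim_tight:
  assumes "good S" "tight (claimed S) (demand (parents S)) T" "x \<in> E `` T"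
  shows "\<exists>S'. good S' \<and> S \<subseteq> S' \<and> x \<in> claimed S'"
  using assms
proof (induction "card T" arbitrary: T S rule: less_induct)
  case less
  let ?X = "claimed S" and ?P = "parents S"
  let ?tight = "tight ?X (demand ?P)"
  have h: "hall ?X (demand ?P)" using less.prems(1) by (simp add: good_def)
  have finT: "finite T" using less.prems(2) by (simp add: tight_def)
  have finN: "finite (E `` T - ?X)" using finT finite_Image_finite by blast
  show ?case
  proof (cases "x \<in> ?X")
    case True
    then show ?thesis using less.prems(1) by blast
  next
    case False
    then have x: "x \<in> E `` T - ?X" using less.prems(3) by blast
    show ?thesis
    proof (cases "T \<inter> ?P = {}")
      case False
      then have less': "card (T - ?P) < card T" using finT by (intro psubset_card_mono) auto
      \<comment> \<open>Members that are already parents demand nothing. Without them the set is a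
        smaller tight set with the same available neighbours.\<close>
      have sum_eq: "sum (demand ?P) (T - ?P) = sum (demand ?P) T"
        using finT by (intro sum.mono_neutral_left) (auto simp: demand_def)
      have sub: "E `` (T - ?P) - ?X \<subseteq> E `` T - ?X" by blast
      have "card (E `` T - ?X) \<le> card (E `` (T - ?P) - ?X)"
        using h finT less.prems(2) sum_eq by (metis finite_Diff hall_def tight_def)
      then have eq: "E `` (T - ?P) - ?X = E `` T - ?X"
        using sub finN by (intro card_seteq)
      then have "?tight (T - ?P)" using less.prems(2) sum_eq by (simp add: tight_def)
      then show ?thesis using less.hyps[OF less' less.prems(1)] x eq by blast
    next
      case disj: True
      have "\<exists>z\<in>T. z \<in> ?X \<or> (\<nexists>T'. ?tight T' \<and> z \<notin> T' \<and> z \<in> E `` T')"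
      proof (cases "T \<inter> ?X = {}")
        case False
        then show ?thesis by blast
      next
        case True
        have "T \<noteq> {}" using less.prems(3) by blast
        \<comment> \<open>A nonempty tight subset of \<open>T\<close> of least size; any of its
          vertices can serve as \<open>z\<close>.\<close>
        then obtain M where M: "M \<subseteq> T" "M \<noteq> {}" "?tight M"
          and min: "\<And>M'. M' \<subseteq> T \<Longrightarrow> M' \<noteq> {} \<Longrightarrow> ?tight M' \<Longrightarrow> card M \<le> card M'"
          using ex_has_least_nat[of "\<lambda>M. M \<subseteq> T \<and> M \<noteq> {} \<and> ?tight M" T card] less.prems(2)
          by (metis order_refl)
        then obtain z where z: "z \<in> M" by blast
        have False if T': "?tight T'" "z \<notin> T'" "z \<in> E `` T'" for T'
        proof -
          \<comment> \<open>By reflexivity \<open>z\<close> is an available neighbour of both tight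
            sets, so they intersect. The intersection is tight and lacks \<open>z\<close>, which
            contradicts the minimality of \<open>M\<close>.\<close>
          have "z \<in> (E `` M - ?X) \<inter> (E `` T' - ?X)"
            using z M(1) T' True refl_E by blast
          then have "M \<inter> T' \<noteq> {}" using tight_Un_Int(3)[OF h M(3) T'(1)] by blast
          then have "card M \<le> card (M \<inter> T')"
            using M(1) tight_Un_Int(2)[OF h M(3) T'(1)] by (intro min) auto
          moreover have "card (M \<inter> T') < card M"
            using z T'(2) M(1) finT by (intro psubset_card_mono) (auto intro: finite_subset)
          ultimately show False by simp
        qed
        then show ?thesis using z M(1) by blast
      qed
      then obtain z where z: "z \<in> T" "z \<in> ?X \<or> (\<nexists>T'. ?tight T' \<and> z \<notin> T' \<and> z \<in> E `` T')"
        by blast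
      have zP: "z \<notin> ?P" using z(1) disj by blast
      obtain S' D where S': "good S'" "S \<subseteq> S'" "claimed S' = ?X \<union> D"
        "parents S' = insert z ?P" "D \<subseteq> E `` {z} - ?X" "card D = K"
        using good_extend[OF less.prems(1) zP z(2)] .
      have h': "hall (?X \<union> D) (demand (insert z ?P))" using S'(1,3,4) by (simp add: good_def)
      \<comment> \<open>Serving \<open>z\<close> removes \<open>K\<close> from the demand and
        \<open>K\<close> available neighbours, so \<open>T - {z}\<close> is tight again and the
        induction applies to it.\<close>
      let ?T = "T - {z}"
      have dT: "sum (demand ?P) T = K * card T"
        using disj by (subst sum.cong[OF refl, of _ _ "\<lambda>_. K"]) (auto simp: demand_def)
      have dT': "sum (demand (insert z ?P)) ?T = K * card ?T"
        using disj by (subst sum.cong[OF refl, of _ _ "\<lambda>_. K"]) (auto simp: demand_def)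
      have D_sub: "D \<subseteq> E `` T - ?X" using S'(5) z(1) by blast
      have "card (E `` T - ?X - D) = K * card T - K"
        using D_sub finN S'(6) less.prems(2) dT
        by (simp add: card_Diff_subset finite_subset tight_def)
      also have "\<dots> = K * card ?T" using z(1) finT by (simp add: algebra_simps)
      also have "\<dots> \<le> card (E `` ?T - (?X \<union> D))"
        using h' finT dT' by (metis finite_Diff hall_def)
      finally have eq: "E `` ?T - (?X \<union> D) = E `` T - ?X - D"
        using finN by (intro card_seteq) auto
      have "tight (claimed S') (demand (parents S')) ?T"
        unfolding tight_def S'(3,4) dT' eq
        using \<open>card (E `` T - ?X - D) = K * card T - K\<close> \<open>K * card T - K = K * card ?T\<close> finT by simp
      moreover have "card ?T < card T" using z(1) finT by (meson card_Diff1_less)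
      ultimately have IH: "\<exists>S''. good S'' \<and> S' \<subseteq> S'' \<and> x \<in> claimed S''" if "x \<in> E `` ?T"
        using less.hyps[OF _ S'(1)] that by blast
      show ?thesis
      proof (cases "x \<in> D")
        case True
        then show ?thesis using S' by blast
      next
        case False
        then have "x \<in> E `` ?T" using x eq by blast
        then show ?thesis using IH S'(2) by (meson order_trans)
      qed
    qed
  qed
qed

text \<open>A claimed vertex can receive its fibre at once. An unclaimed one may become a fixed
  point unless it is a neighbour of a tight set avoiding it; in that case it first gets claimed by
  means of this tight set.\<close>

lemma good_extend_parent:
  assumes "good S"
  shows "\<exists>S'. good S' \<and> S \<subseteq> S' \<and> x \<in> parents S'"
proof -
  have claimed: "\<exists>S'. good S' \<and> S \<subseteq> S' \<and> x \<in> parents S'" if "good S" "x \<in> claimed S" for S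
  proof (cases "x \<in> parents S")
    case False
    then show ?thesis using good_extend[OF that(1)] that(2) by (metis insertI1)
  qed (use that in blast)
  show ?thesis
  proof (cases "x \<in> claimed S")
    case True
    then show ?thesis using claimed assms by blast
  next
    case False
    show ?thesis
    proof (cases "\<exists>T. tight (claimed S) (demand (parents S)) T \<and> x \<notin> T \<and> x \<in> E `` T")
      case True
      then obtain S' where "good S'" "S \<subseteq> S'" "x \<in> claimed S'"
        using good_claim_tight[OF assms] by blast
      then show ?thesis using claimed by (meson order_trans)
    next
      case free: False
      have "x \<notin> parents S" using False parents_subset_claimed[OF assms] by blast
      then show ?thesis using good_extend[OF assms] free by (metis insertI1)
    qed
  qed
qed

text \<open>A set violating Hall's condition has fewer than \<open>card X\<close> elements, so it misses one of the
  first \<open>card X\<close> shells around \<open>X\<close>. The part beyond that shell keeps all its neighbours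
  and shares none with the part within.\<close>

lemma hall_local:
  assumes X: "finite X" and B0: "E `` X \<subseteq> B 0"
    and B: "\<And>j. E `` (E `` B j) \<subseteq> B (Suc j)"
    and r: "card X \<le> r"
    and loc: "\<And>F. finite F \<Longrightarrow> F \<subseteq> B r \<Longrightarrow> F \<inter> P = {} \<Longrightarrow> K * card F \<le> card (E `` F - X)"
  shows "hall X (demand P)"
proof -
  have mono: "B i \<subseteq> B j" if "i \<le> j" for i j
  proof (rule lift_Suc_mono_le[OF _ that])
    show "B n \<le> B (Suc n)" for n using B[of n] refl_E by blast
  qed
  have main: "K * card F \<le> card (E `` F - X)" if F: "finite F" "F \<inter> P = {}" for F
  proof (cases "card X \<le> card F")
    case True
    \<comment> \<open>Removing \<open>X\<close> costs at most \<open>card X \<le> card F\<close>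
      neighbours, which the surplus in the expansion covers.\<close>
    have "card (E `` F) - card X \<le> card (E `` F - X)" using X by (rule diff_card_le_card_Diff)
    then show ?thesis using True expanding[OF F(1)] by simp
  next
    case False
    have "\<exists>j<r. F \<inter> (B (Suc j) - B j) = {}"
    proof (rule ccontr)
      assume "\<not> ?thesis"
      then have "\<forall>j<r. \<exists>x. x \<in> F \<inter> (B (Suc j) - B j)" by blast
      then obtain f where f: "\<And>j. j < r \<Longrightarrow> f j \<in> F \<inter> (B (Suc j) - B j)" by metis
      \<comment> \<open>Points chosen in different shells are different, so \<open>F\<close> would
        have at least \<open>r\<close> elements.\<close>
      have "inj_on f {..<r}"
      proof (rule linorder_inj_onI)
        fix i j :: nat assume ij: "i < j" "i \<in> {..<r}" "j \<in> {..<r}"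
        then have "f i \<in> B (Suc i)" "f j \<notin> B j" using f by auto
        then show "f i \<noteq> f j" using mono[of "Suc i" j] ij by auto
      qed auto
      then have "r \<le> card F" using f F(1) by (metis Int_iff card_inj_on_le card_lessThan image_subsetI lessThan_iff)
      then show False using False r by simp
    qed
    then obtain j where j: "j < r" "F \<inter> (B (Suc j) - B j) = {}" by blast
    define F1 where "F1 = F \<inter> B j"
    define F2 where "F2 = F - B j"
    have F12: "F = F1 \<union> F2" "F1 \<inter> F2 = {}" "finite F1" "finite F2"
      using F by (auto simp: F1_def F2_def)
    have F2_far: "F2 \<inter> B (Suc j) = {}" using j(2) by (auto simp: F2_def)
    \<comment> \<open>A common neighbour would put a point of \<open>F2\<close> within two steps of
      \<open>B j\<close>, hence into \<open>B (Suc j)\<close>.\<close>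
    have disj: "E `` F1 \<inter> E `` F2 = {}"
    proof (rule ccontr)
      assume "E `` F1 \<inter> E `` F2 \<noteq> {}"
      then obtain a b y where "a \<in> F1" "(a, y) \<in> E" "b \<in> F2" "(b, y) \<in> E" by blast
      then have "b \<in> E `` (E `` B j)" using sym_E by (auto simp: F1_def dest: symD)
      then show False using B[of j] F2_far \<open>b \<in> F2\<close> by blast
    qed
    have "E `` F2 \<inter> X = {}"
    proof (rule ccontr)
      assume "E `` F2 \<inter> X \<noteq> {}"
      then obtain b y where "b \<in> F2" "(b, y) \<in> E" "y \<in> X" by blast
      then have "b \<in> B 0" using B0 sym_E by (auto dest: symD)
      then show False using mono[of 0 j] \<open>b \<in> F2\<close> by (auto simp: F2_def)
    qed
    then have split: "E `` F - X = (E `` F1 - X) \<union> E `` F2" using F12(1) by blast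
    have "card (E `` F - X) = card (E `` F1 - X) + card (E `` F2)"
      unfolding split using disj F12 finite_Image_finite by (intro card_Un_disjoint) auto
    moreover have "K * card F1 \<le> card (E `` F1 - X)"
    proof (rule loc[OF F12(3)])
      show "F1 \<subseteq> B r" using mono[of j r] j(1) by (auto simp: F1_def)
      show "F1 \<inter> P = {}" using F(2) by (auto simp: F1_def)
    qed
    moreover have "K * card F2 \<le> card (E `` F2)"
      using expanding[OF F12(4)] by simp
    moreover have "card F = card F1 + card F2"
      unfolding F12(1) using F12(2-4) by (rule card_Un_disjoint[rotated 2])
    ultimately show ?thesis by (simp add: distrib_left)
  qed
  show ?thesis
    unfolding hall_def
  proof (intro allI impI)
    fix F :: "'a set" assume F: "finite F"
    have "sum (demand P) F = sum (demand P) (F - P)"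
      using F by (intro sum.mono_neutral_right) (auto simp: demand_def)
    also have "\<dots> = K * card (F - P)"
      by (subst sum.cong[OF refl, of _ _ "\<lambda>_. K"]) (auto simp: demand_def)
    also have "\<dots> \<le> card (E `` (F - P) - X)" using F by (intro main) auto
    also have "\<dots> \<le> card (E `` F - X)"
      using F finite_Image_finite by (intro card_mono) auto
    finally show "sum (demand P) F \<le> card (E `` F - X)" .
  qed
qed

lemma hall_demandD:
  assumes "hall X (demand P)" "finite F" "F \<inter> P = {}"
  shows "K * card F \<le> card (E `` F - X)"
proof -
  have "sum (demand P) F = K * card F"
    using assms(3) by (subst sum.cong[OF refl, of _ _ "\<lambda>_. K"]) (auto simp: demand_def)
  then show ?thesis using assms by (metis hall_def)
qed

end

section \<open>A computable surjection with fibres of constant size\<close>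

lemma mem_set_decode_less: "k \<in> set_decode c \<Longrightarrow> k < c"
proof -
  assume "k \<in> set_decode c"
  then have "odd (c div 2 ^ k)" by (simp add: set_decode_def)
  then have "c div 2 ^ k \<noteq> 0" by (intro notI) simp
  then have "2 ^ k \<le> c" by (simp add: div_eq_0_iff)
  then show ?thesis using less_exp[of k] by linarith
qed

text \<open>A number stands for a finite set of triples: its binary digits mark the codes of the
  triples.\<close>

definition entries :: "nat \<Rightarrow> (nat \<times> nat \<times> nat) set" where
  "entries c = {(y, z, t). prod_encode (y, prod_encode (z, t)) \<in> set_decode c}"

text \<open>A number exceeds the positions of its nonzero digits, and a position is at least as
  large as the components that it codes. Quantifiers over triples thereby become bounded.\<close>

lemma entries_less:
  assumes "(y, z, t) \<in> entries c"
  shows "y < c" "z < c" "t < c"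
proof -
  have "prod_encode (y, prod_encode (z, t)) < c"
    using assms by (simp add: entries_def mem_set_decode_less)
  moreover note le_prod_encode_1[of y "prod_encode (z, t)"] le_prod_encode_2[of "prod_encode (z, t)" y]
    le_prod_encode_1[of z t] le_prod_encode_2[of t z]
  ultimately show "y < c" "z < c" "t < c" by linarith+
qed

lemma finite_entries: "finite (entries c)"
  by (rule finite_subset[of _ "{..<c} \<times> {..<c} \<times> {..<c}"]) (auto dest: entries_less)

lemma entries_surj:
  assumes "finite S"
  obtains c where "entries c = S"
proof -
  let ?f = "\<lambda>(y, z, t). prod_encode (y, prod_encode (z, t))"
  have "entries (set_encode (?f ` S)) = S"
    using assms by (force simp: entries_def)
  then show thesis using that by blast
qed

lemma set_decode_subset_iff: "set_decode b \<subseteq> set_decode c \<longleftrightarrow> entries b \<subseteq> entries c"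
proof
  assume sub: "entries b \<subseteq> entries c"
  show "set_decode b \<subseteq> set_decode c"
  proof
    fix k assume k: "k \<in> set_decode b"
    obtain y z t where "k = prod_encode (y, prod_encode (z, t))"
      by (metis prod_decode_inverse surj_pair)
    then show "k \<in> set_decode c" using k sub by (auto simp: entries_def)
  qed
qed (auto simp: entries_def)

lemma dec_entries:
  assumes "cmp k a" "cmp k b" "cmp k c" "cmp k d"
  shows "dec k (\<lambda>xs. (a xs, b xs, c xs) \<in> entries (d xs))"
  unfolding entries_def mem_Collect_eq prod.case
  by (intro dec_set_decode cmp_prod_encode assms)

locale computable_expanding_relation = expanding_relation E K
  for E :: "(nat \<times> nat) set" and K +
  assumes highly_computable: "highly_computable E"
begin

section \<open>Decidability of goodness\<close>

lemma dec_E: "cmp k a \<Longrightarrow> cmp k b \<Longrightarrow> dec k (\<lambda>xs. (a xs, b xs) \<in> E)"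
  using highly_computable cmp_app2[of "\<lambda>x y. of_bool ((x, y) \<in> E)" k a b]
  by (simp add: highly_computable_def computable_rel_iff_dec)

text \<open>Neighbours below \<open>b\<close> are counted until their number reaches the degree for
  every \<open>x < m\<close>; then none is missed. Computability of the degrees makes this search
  effective.\<close>

definition bound :: "nat \<Rightarrow> nat" where
  "bound m = (LEAST b. m \<le> b \<and> (\<forall>x<m. card {y. y < b \<and> (x, y) \<in> E} = card (E `` {x})))"

lemma bound_ex: "\<exists>b. m \<le> b \<and> (\<forall>x<m. card {y. y < b \<and> (x, y) \<in> E} = card (E `` {x}))"
proof -
  have "finite (E `` {..<m})" by (intro finite_Image_finite) simp
  then obtain b where b: "\<And>y. y \<in> E `` {..<m} \<Longrightarrow> y < b"
    by (meson finite_nat_set_iff_bounded)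
  have "{y. y < max m b \<and> (x, y) \<in> E} = E `` {x}" if "x < m" for x
    using b that by (fastforce simp: less_max_iff_disj)
  then show ?thesis by (intro exI[of _ "max m b"]) simp
qed

lemma Image_lessThan_bound: "E `` {..<m} \<subseteq> {..<bound m}"
proof -
  have *: "\<forall>x<m. card {y. y < bound m \<and> (x, y) \<in> E} = card (E `` {x})"
    using LeastI_ex[OF bound_ex[of m]] unfolding bound_def[symmetric] by blast
  have "{y. y < bound m \<and> (x, y) \<in> E} = E `` {x}" if "x < m" for x
    using * that finite_Image by (intro card_subset_eq) auto
  then show ?thesis by blast
qed

lemma cmp_bound: "cmp k a \<Longrightarrow> cmp k (\<lambda>xs. bound (a xs))"
proof (rule cmp_app1[of bound])
  have deg: "cmp 1 (\<lambda>xs. card (E `` {hd xs}))"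
    using highly_computable by (simp add: highly_computable_def computable_fun_iff_cmp)
  show "cmp 1 (\<lambda>xs. bound (hd xs))"
    unfolding bound_def
  proof (rule cmp_Least)
    show "dec (Suc 1) (\<lambda>ys. hd (tl ys) \<le> hd ys \<and>
        (\<forall>x<hd (tl ys). card {y. y < hd ys \<and> (x, y) \<in> E} = card (E `` {x})))"
      by (intro cmp_intros dec_E cmp_app1[of "\<lambda>x. card (E `` {x})", OF deg]; simp)
  qed (rule bound_ex)
qed

text \<open>One step from the vertices below \<open>c\<close> covers the neighbours of the claimed
  ones. Two further steps are made for each of \<open>c\<close> shells, \<open>c\<close> being a
  bound on the number of claimed vertices.\<close>

definition radius :: "nat \<Rightarrow> nat" where
  "radius c = (bound ^^ (2 * c + 1)) c"

lemma cmp_radius: "cmp k a \<Longrightarrow> cmp k (\<lambda>xs. radius (a xs))"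
proof (rule cmp_app1[of radius])
  show "cmp 1 (\<lambda>xs. radius (hd xs))"
    unfolding radius_def
    by (intro cmp_funpow cmp_bound cmp_intros; simp)
qed

text \<open>By \<open>hall_local\<close> Hall's condition need be tested only on subsets of
  \<open>{..<radius c}\<close>, which are the sets coded by the numbers below
  \<open>2 ^ radius c\<close>. The remaining quantifiers are bounded as well, so this form exhibits
  goodness as decidable.\<close>

lemma good_entries_iff:
  "good (entries c) \<longleftrightarrow>
    (\<forall>y<c. \<forall>z<c. \<forall>t<c. (y, z, t) \<in> entries c \<longrightarrow>
      (\<forall>z'<c. \<forall>t'<c. (y, z', t') \<in> entries c \<longrightarrow> z = z' \<and> t = t') \<and>
      (z, y) \<in> E \<and> card {y'. y' < c \<and> (\<exists>t'<c. (y', z, t') \<in> entries c)} = K \<and>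
      (y = z \<or> (\<exists>z'<c. \<exists>t'<t. (z, z', t') \<in> entries c))) \<and>
    (\<forall>f<2 ^ radius c.
      (\<forall>z<radius c. z \<in> set_decode f \<longrightarrow> \<not> (\<exists>y<c. \<exists>t<c. (y, z, t) \<in> entries c)) \<longrightarrow>
      K * card {x. x < radius c \<and> x \<in> set_decode f} \<le>
        card {y. y < bound (radius c) \<and> (\<exists>x<radius c. x \<in> set_decode f \<and> (x, y) \<in> E) \<and>
          \<not> (\<exists>z<c. \<exists>t<c. (y, z, t) \<in> entries c)})"
  (is "_ \<longleftrightarrow> ?valid \<and> ?hall")
proof -
  have fib: "{y'. y' < c \<and> (\<exists>t'<c. (y', z, t') \<in> entries c)} = fibre (entries c) z" for z
    by (auto simp: fibre_def dest: entries_less)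
  have cl: "(\<exists>z<c. \<exists>t<c. (y, z, t) \<in> entries c) \<longleftrightarrow> y \<in> claimed (entries c)" for y
    by (auto simp: claimed_def dest: entries_less)
  have par: "(\<exists>y<c. \<exists>t<c. (y, z, t) \<in> entries c) \<longleftrightarrow> z \<in> parents (entries c)" for z
    by (auto simp: parents_def dest: entries_less)
  have ex: "(\<exists>z'<c. \<exists>t'<t. (z, z', t') \<in> entries c) \<longleftrightarrow> (\<exists>z' t'. t' < t \<and> (z, z', t') \<in> entries c)"
    for z t by (auto dest: entries_less)
  have all3: "(\<forall>y<c. \<forall>z<c. \<forall>t<c. (y, z, t) \<in> entries c \<longrightarrow> Q y z t) \<longleftrightarrow>
    (\<forall>y z t. (y, z, t) \<in> entries c \<longrightarrow> Q y z t)" for Q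
    using entries_less[of _ _ _ c] by blast
  have all2: "(\<forall>z<c. \<forall>t<c. (y, z, t) \<in> entries c \<longrightarrow> Q z t) \<longleftrightarrow>
    (\<forall>z t. (y, z, t) \<in> entries c \<longrightarrow> Q z t)" for y Q
    using entries_less[of y _ _ c] by blast
  have "valid (entries c) \<longleftrightarrow> ?valid"
    unfolding valid_def fib ex all3 unfolding all2 by blast
  moreover have "hall (claimed (entries c)) (demand (parents (entries c))) \<longleftrightarrow> ?hall"
  proof -
    let ?r = "radius c" and ?X = "claimed (entries c)" and ?P = "parents (entries c)"
    have small: "F \<subseteq> {..<?r} \<longleftrightarrow> (\<exists>f<2 ^ ?r. F = set_decode f)" for F
    proof
      assume F: "F \<subseteq> {..<?r}"
      then have fin: "finite F" by (rule finite_subset) simp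
      have "set_encode F \<le> set_encode {..<?r}"
        unfolding set_encode_def using F by (intro sum_mono2) auto
      also have "\<dots> < 2 ^ ?r"
        unfolding set_encode_def using sum_power2[of ?r] by (simp add: lessThan_atLeast0)
      finally show "\<exists>f<2 ^ ?r. F = set_decode f" using fin by (metis set_encode_inverse)
    next
      assume "\<exists>f<2 ^ ?r. F = set_decode f"
      then obtain f where f: "f < 2 ^ ?r" "F = set_decode f" by blast
      have "x < ?r" if "x \<in> F" for x
      proof (rule ccontr)
        assume "\<not> x < ?r"
        then have "(2::nat) ^ ?r \<le> 2 ^ x" by (intro power_increasing) auto
        then have "f < 2 ^ x" using f(1) by linarith
        then have "f div 2 ^ x = 0" by simp
        then show False using that f(2) by (simp add: set_decode_def)
      qed
      then show "F \<subseteq> {..<?r}" by blast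
    qed
    have eq: "(\<forall>z<?r. z \<in> F \<longrightarrow> z \<notin> ?P) \<longleftrightarrow> F \<inter> ?P = {}"
      "{x. x < ?r \<and> x \<in> F} = F"
      "{y. y < bound ?r \<and> (\<exists>x<?r. x \<in> F \<and> (x, y) \<in> E) \<and> y \<notin> ?X} = E `` F - ?X"
      if "F \<subseteq> {..<?r}" for F
      using that Image_lessThan_bound[of ?r] by blast+
    have "hall ?X (demand ?P) \<longleftrightarrow>
      (\<forall>F\<subseteq>{..<?r}. F \<inter> ?P = {} \<longrightarrow> K * card F \<le> card (E `` F - ?X))"
    proof
      assume "hall ?X (demand ?P)"
      then show "\<forall>F\<subseteq>{..<?r}. F \<inter> ?P = {} \<longrightarrow> K * card F \<le> card (E `` F - ?X)"
        using hall_demandD by (meson finite_lessThan finite_subset)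
    next
      assume loc: "\<forall>F\<subseteq>{..<?r}. F \<inter> ?P = {} \<longrightarrow> K * card F \<le> card (E `` F - ?X)"
      let ?B = "\<lambda>j. {..<(bound ^^ (2 * j + 1)) c}"
      have X: "?X \<subseteq> {..<c}" by (auto simp: claimed_def dest: entries_less)
      show "hall ?X (demand ?P)"
      proof (rule hall_local)
        show "finite ?X" using X by (rule finite_subset) simp
        show "card ?X \<le> c" using card_mono[OF _ X] by simp
        show "E `` ?X \<subseteq> ?B 0" using X Image_lessThan_bound[of c] by auto
        show "E `` (E `` ?B j) \<subseteq> ?B (Suc j)" for j
        proof -
          let ?m = "(bound ^^ (2 * j + 1)) c"
          have "E `` (E `` {..<?m}) \<subseteq> E `` {..<bound ?m}"
            by (intro Image_mono Image_lessThan_bound order_refl)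
          also have "\<dots> \<subseteq> {..<bound (bound ?m)}" by (rule Image_lessThan_bound)
          finally show ?thesis by simp
        qed
        show "K * card F \<le> card (E `` F - ?X)" if "finite F" "F \<subseteq> ?B c" "F \<inter> ?P = {}" for F
          using loc that unfolding radius_def by blast
      qed
    qed
    also have "\<dots> \<longleftrightarrow> (\<forall>f<2 ^ ?r. set_decode f \<inter> ?P = {} \<longrightarrow>
        K * card (set_decode f) \<le> card (E `` set_decode f - ?X))"
      unfolding small by blast
    also have "\<dots> \<longleftrightarrow> ?hall"
    proof (rule all_cong)
      fix f :: nat assume "f < 2 ^ ?r"
      then have "set_decode f \<subseteq> {..<?r}" using small by blast
      then show "(set_decode f \<inter> ?P = {} \<longrightarrow>
          K * card (set_decode f) \<le> card (E `` set_decode f - ?X)) \<longleftrightarrow>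
        ((\<forall>z<?r. z \<in> set_decode f \<longrightarrow> \<not> (\<exists>y<c. \<exists>t<c. (y, z, t) \<in> entries c)) \<longrightarrow>
          K * card {x. x < ?r \<and> x \<in> set_decode f} \<le>
          card {y. y < bound ?r \<and> (\<exists>x<?r. x \<in> set_decode f \<and> (x, y) \<in> E) \<and>
            \<not> (\<exists>z<c. \<exists>t<c. (y, z, t) \<in> entries c)})"
        unfolding cl par by (simp only: eq)
    qed
    finally show ?thesis .
  qed
  ultimately show ?thesis by (simp only: good_def finite_entries simp_thms)
qed

lemma dec_good: "dec 1 (\<lambda>xs. good (entries (hd xs)))"
  unfolding good_entries_iff
  by (intro cmp_intros dec_entries cmp_radius cmp_bound dec_E; simp)

section \<open>The stages of the construction\<close>

definition stage_step :: "nat \<Rightarrow> nat \<Rightarrow> nat" where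
  "stage_step n s = (LEAST c. good (entries s) \<longrightarrow>
    good (entries c) \<and> entries s \<subseteq> entries c \<and> n \<in> parents (entries c))"

definition stage :: "nat \<Rightarrow> nat" where
  "stage n = rec_nat 0 stage_step n"

text \<open>If \<open>entries s\<close> is not good, any \<open>c\<close> satisfies the implication;
  hence the search terminates for all arguments, as \<open>cmp_Least\<close> demands.\<close>

lemma stage_step_ex: "\<exists>c. good (entries s) \<longrightarrow>
    good (entries c) \<and> entries s \<subseteq> entries c \<and> n \<in> parents (entries c)"
  using good_extend_parent[of "entries s" n] entries_surj by (metis good_def)

lemma cmp_stage: "cmp k a \<Longrightarrow> cmp k (\<lambda>xs. stage (a xs))"
proof -
  assume a: "cmp k a"
  have "cmp 2 (\<lambda>xs. stage_step (hd xs) (hd (tl xs)))"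
    unfolding stage_step_def
  proof (rule cmp_Least)
    have par: "n \<in> parents (entries c) \<longleftrightarrow> (\<exists>y<c. \<exists>t<c. (y, n, t) \<in> entries c)" for n c
      by (auto simp: parents_def dest: entries_less)
    have sub: "entries b \<subseteq> entries c \<longleftrightarrow> (\<forall>k<b. k \<in> set_decode b \<longrightarrow> k \<in> set_decode c)" for b c
      unfolding set_decode_subset_iff[symmetric] by (auto dest: mem_set_decode_less)
    show "dec (Suc 2) (\<lambda>ys. good (entries (hd (tl (tl ys)))) \<longrightarrow>
        good (entries (hd ys)) \<and> entries (hd (tl (tl ys))) \<subseteq> entries (hd ys) \<and>
        hd (tl ys) \<in> parents (entries (hd ys)))"
      unfolding par sub
      by (intro cmp_intros dec_entries cmp_app1[of "\<lambda>c. of_bool (good (entries c))", OF dec_good]; simp)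
  qed (rule stage_step_ex)
  then have "cmp (Suc (Suc k)) (\<lambda>ys. stage_step (hd ys) (hd (tl ys)))"
    by (rule cmp_app2[of stage_step]) (intro cmp_intros; simp)+
  then have "cmp k (\<lambda>xs. rec_nat 0 (\<lambda>n s. stage_step n s) (a xs))"
    by (rule cmp_rec[OF cmp_const a])
  then show ?thesis by (simp add: stage_def)
qed

lemma stage_Suc:
  assumes "good (entries (stage n))"
  shows "good (entries (stage (Suc n)))" "entries (stage n) \<subseteq> entries (stage (Suc n))"
    "n \<in> parents (entries (stage (Suc n)))"
proof -
  have "stage (Suc n) = stage_step n (stage n)" by (simp add: stage_def)
  then show "good (entries (stage (Suc n)))" "entries (stage n) \<subseteq> entries (stage (Suc n))"
    "n \<in> parents (entries (stage (Suc n)))"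
    using LeastI_ex[OF stage_step_ex[of "stage n" n]] assms unfolding stage_step_def by auto
qed

lemma good_stage: "good (entries (stage n))"
proof (induction n)
  case 0
  have "entries (stage 0) = {}" by (simp add: stage_def entries_def)
  then show ?case by (simp add: good_empty)
qed (rule stage_Suc)

lemma stage_mono: "m \<le> n \<Longrightarrow> entries (stage m) \<subseteq> entries (stage n)"
  by (rule lift_Suc_mono_le[of "\<lambda>n. entries (stage n)"]) (rule stage_Suc[OF good_stage])

lemma stage_functional:
  assumes "(y, z, t) \<in> entries (stage m)" "(y, z', t') \<in> entries (stage n)"
  shows "z = z' \<and> t = t'"
proof -
  have "(y, z, t) \<in> entries (stage (max m n))" "(y, z', t') \<in> entries (stage (max m n))"
    using assms stage_mono[of m "max m n"] stage_mono[of n "max m n"] by auto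
  then show ?thesis using good_stage[of "max m n"] unfolding good_def valid_def by blast
qed

lemma stage_valid:
  assumes "(y, z, t) \<in> entries (stage m)"
  shows "(z, y) \<in> E" "card (fibre (entries (stage m)) z) = K"
    "y = z \<or> (\<exists>z' t'. t' < t \<and> (z, z', t') \<in> entries (stage m))"
  using good_stage[of m] assms unfolding good_def valid_def by blast+

section \<open>The limit map and its properties\<close>

definition parent :: "nat \<Rightarrow> nat" where
  "parent y = (LEAST z. \<exists>t<stage (Suc y). (y, z, t) \<in> entries (stage (Suc y)))"

text \<open>By stage \<open>Suc y\<close> the vertex \<open>y\<close> has become a parent, hence is
  claimed. So its own parent can be read off there.\<close>

lemma stage_claims: "\<exists>z t. t < stage (Suc y) \<and> (y, z, t) \<in> entries (stage (Suc y))"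
proof -
  have "y \<in> claimed (entries (stage (Suc y)))"
    using stage_Suc(3)[OF good_stage] parents_subset_claimed[OF good_stage] by blast
  then show ?thesis by (auto simp: claimed_def dest: entries_less)
qed

lemma parent_eq_iff: "parent y = z \<longleftrightarrow> (\<exists>m t. (y, z, t) \<in> entries (stage m))"
proof -
  have "\<exists>t<stage (Suc y). (y, parent y, t) \<in> entries (stage (Suc y))"
    unfolding parent_def by (rule LeastI_ex) (use stage_claims in blast)
  then show ?thesis using stage_functional by blast
qed

lemma computable_parent: "computable_fun parent"
  unfolding computable_fun_iff_cmp parent_def
proof (rule cmp_Least)
  show "dec (Suc 1) (\<lambda>ys. \<exists>t<stage (Suc (hd (tl ys))).
      (hd (tl ys), hd ys, t) \<in> entries (stage (Suc (hd (tl ys)))))"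
    by (intro cmp_intros dec_entries cmp_stage; simp)
qed (use stage_claims in blast)

text \<open>A fibre has \<open>K\<close> elements from the stage on at which its vertex is a parent.
  A later stage contains the old fibre and has one of the same size, so the fibre never
  changes.\<close>

lemma card_parent_fibre: "card {y. parent y = z} = K"
proof -
  obtain y t where yt: "(y, z, t) \<in> entries (stage (Suc z))"
    using stage_Suc(3)[OF good_stage, of z] unfolding parents_def by blast
  have "x \<in> fibre (entries (stage (Suc z))) z" if x: "(x, z, u) \<in> entries (stage m)" for x u m
  proof -
    let ?n = "max m (Suc z)"
    have sub: "entries (stage (Suc z)) \<subseteq> entries (stage ?n)" "entries (stage m) \<subseteq> entries (stage ?n)"
      by (simp_all add: stage_mono)
    have "fibre (entries (stage (Suc z))) z = fibre (entries (stage ?n)) z"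
    proof (rule card_subset_eq)
      show "finite (fibre (entries (stage ?n)) z)"
        by (rule finite_subset[of _ "{..<stage ?n}"]) (auto simp: fibre_def dest: entries_less)
      show "fibre (entries (stage (Suc z))) z \<subseteq> fibre (entries (stage ?n)) z"
        using sub(1) by (auto simp: fibre_def)
      show "card (fibre (entries (stage (Suc z))) z) = card (fibre (entries (stage ?n)) z)"
        using stage_valid(2) yt sub(1) by (metis subsetD)
    qed
    moreover have "x \<in> fibre (entries (stage ?n)) z" using x sub(2) by (auto simp: fibre_def)
    ultimately show ?thesis by simp
  qed
  then have "{y. parent y = z} = fibre (entries (stage (Suc z))) z"
    unfolding parent_eq_iff by (auto simp: fibre_def)
  then show ?thesis using stage_valid(2)[OF yt] by simp
qed

text \<open>Induction on the rank inside one stage: the parent of a vertex that is not fixed has a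
  triple of smaller rank.\<close>

lemma parent_reaches_fixpoint: "\<exists>n. parent ((parent ^^ n) y) = (parent ^^ n) y"
proof -
  have "\<exists>n. parent ((parent ^^ n) y) = (parent ^^ n) y" if "(y, z, t) \<in> entries (stage m)" for y z t m
    using that
  proof (induction t arbitrary: y z rule: less_induct)
    case (less t)
    then have p: "parent y = z" using parent_eq_iff by blast
    from stage_valid(3)[OF less.prems] show ?case
    proof
      assume "y = z"
      then show ?thesis using p by (intro exI[of _ 0]) simp
    next
      assume "\<exists>z' t'. t' < t \<and> (z, z', t') \<in> entries (stage m)"
      then obtain n where "parent ((parent ^^ n) z) = (parent ^^ n) z" using less.IH by blast
      then show ?thesis using p by (intro exI[of _ "Suc n"]) (simp add: funpow_swap1)
    qed
  qed
  then show ?thesis using stage_claims by blast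
qed

lemma parent_edge: "(parent y, y) \<in> E"
  using stage_valid(1) parent_eq_iff by blast

end

section \<open>Forests given by a parent function\<close>

text \<open>Roots are encoded as the fixed points of the parent function.\<close>

definition forest_of :: "('a \<Rightarrow> 'a) \<Rightarrow> ('a \<times> 'a) set" where
  "forest_of h = {(x, y). h y = x \<and> x \<noteq> y}"

lemma adjacency_forest_of:
  "(a, b) \<in> adjacency (forest_of h) \<longleftrightarrow> a \<noteq> b \<and> (h a = b \<or> h b = a)"
  by (auto simp: adjacency_def forest_of_def)

text \<open>On a cycle, take a vertex where \<open>\<mu>\<close> is largest. Neither of its
  neighbours can have it as parent, so both are equal to its own parent; in a cycle of length at
  least 3 they are distinct.\<close>

lemma acyclic_forest_of:
  fixes \<mu> :: "'a \<Rightarrow> nat"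
  assumes dec: "\<And>y. h y \<noteq> y \<Longrightarrow> \<mu> (h y) < \<mu> y"
  shows "\<not> cycle (forest_of h) vs"
proof
  assume "cycle (forest_of h) vs"
  then have ne: "vs \<noteq> []" and n2: "length vs \<noteq> 2" and dist: "distinct vs"
    and adj: "\<And>i. i < length vs \<Longrightarrow>
      vs ! i \<noteq> vs ! (Suc i mod length vs) \<and>
      (h (vs ! i) = vs ! (Suc i mod length vs) \<or> h (vs ! (Suc i mod length vs)) = vs ! i)"
    by (auto simp: cycle_def adjacency_forest_of)
  let ?n = "length vs"
  obtain i where i: "i < ?n" and max: "\<And>j. j < ?n \<Longrightarrow> \<mu> (vs ! j) \<le> \<mu> (vs ! i)"
  proof -
    have "finite (\<mu> ` set vs)" "\<mu> ` set vs \<noteq> {}" using ne by auto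
    from Max_in[OF this] obtain i where "i < ?n" "\<mu> (vs ! i) = Max (\<mu> ` set vs)"
      by (metis image_iff in_set_conv_nth)
    then show thesis by (intro that[of i]) auto
  qed
  define j where "j = (if i = 0 then ?n - 1 else i - 1)"
  have j: "j < ?n" "Suc j mod ?n = i" using i by (auto simp: j_def)
  have k: "Suc i mod ?n < ?n" by (rule mod_less_divisor) (use i in linarith)
  \<comment> \<open>Length 1 would be a loop, and \<open>forest_of\<close> contains none.\<close>
  have "?n \<noteq> 1" using adj[OF i] i by (cases "?n = 1") auto
  then have "Suc i mod ?n \<noteq> j"
    using i n2 by (cases "Suc i = ?n") (auto simp: j_def split: if_splits)
  then have "vs ! (Suc i mod ?n) \<noteq> vs ! j" using dist k j(1) by (simp add: nth_eq_iff_index_eq)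
  moreover have "h (vs ! i) = vs ! (Suc i mod ?n)"
    using adj[OF i] dec[of "vs ! (Suc i mod ?n)"] max[OF k] by force
  moreover have "h (vs ! i) = vs ! j"
    using adj[OF j(1)] dec[of "vs ! j"] max[OF j(1)] unfolding j(2) by force
  ultimately show False by simp
qed

definition root_of :: "('a \<Rightarrow> 'a) \<Rightarrow> 'a \<Rightarrow> 'a" where
  "root_of h y = (h ^^ (LEAST n. h ((h ^^ n) y) = (h ^^ n) y)) y"

text \<open>Adjacent vertices have the same root, and every vertex is joined to its root along its
  orbit.\<close>

lemma same_component_forest_of:
  assumes ex: "\<And>y. \<exists>n. h ((h ^^ n) y) = (h ^^ n) y"
  shows "(x, y) \<in> same_component (forest_of h) \<longleftrightarrow> root_of h x = root_of h y"
proof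
  have root: "h (root_of h y) = root_of h y" for y
    unfolding root_of_def by (rule LeastI_ex[OF ex])
  have fixed: "(h ^^ n) r = r" if "h r = r" for n r
    using that by (induction n) auto
  \<comment> \<open>Once an orbit reaches a fixed point it stays there, so any two fixed points on
    it coincide.\<close>
  have unique: "(h ^^ n) y = (h ^^ m) y"
    if "h ((h ^^ n) y) = (h ^^ n) y" "n \<le> m" for n m y
  proof -
    have "(h ^^ (m - n + n)) y = (h ^^ (m - n)) ((h ^^ n) y)" by (simp only: funpow_add o_apply)
    then have "(h ^^ m) y = (h ^^ (m - n)) ((h ^^ n) y)" using that(2) by simp
    then show ?thesis using fixed[OF that(1)] by simp
  qed
  have step: "root_of h (h y) = root_of h y" for y
  proof -
    let ?n = "LEAST n. h ((h ^^ n) (h y)) = (h ^^ n) (h y)"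
    let ?m = "LEAST n. h ((h ^^ n) y) = (h ^^ n) y"
    have "root_of h (h y) = (h ^^ Suc ?n) y" by (simp add: root_of_def funpow_swap1)
    moreover have "h ((h ^^ Suc ?n) y) = (h ^^ Suc ?n) y"
      using root[of "h y"] by (simp add: root_of_def funpow_swap1)
    moreover have "h ((h ^^ ?m) y) = (h ^^ ?m) y" using root[of y] by (simp add: root_of_def)
    ultimately have "(h ^^ ?m) y = root_of h (h y)"
      using unique[of "Suc ?n" y ?m] unique[of ?m y "Suc ?n"] by (cases "?m \<le> Suc ?n") simp_all
    then show ?thesis by (simp add: root_of_def)
  qed
  show "root_of h x = root_of h y" if "(x, y) \<in> same_component (forest_of h)"
    using that unfolding same_component_def
  proof (induction rule: rtrancl_induct)
    case (step y z)
    then show ?case using \<open>\<And>y. root_of h (h y) = root_of h y\<close> by (metis adjacency_forest_of)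
  qed simp
  have sym: "sym ((adjacency (forest_of h))\<^sup>*)"
    by (intro sym_rtrancl) (auto simp: sym_def adjacency_def)
  have reach: "(y, (h ^^ n) y) \<in> (adjacency (forest_of h))\<^sup>*" for n y
  proof (induction n)
    case (Suc n)
    have "((h ^^ n) y, (h ^^ Suc n) y) \<in> (adjacency (forest_of h))\<^sup>*"
      by (cases "h ((h ^^ n) y) = (h ^^ n) y") (auto simp: adjacency_forest_of)
    then show ?case using Suc by (rule rtrancl_trans[rotated])
  qed simp
  have root_reach: "(y, root_of h y) \<in> (adjacency (forest_of h))\<^sup>*" for y
    unfolding root_of_def by (rule reach)
  show "(x, y) \<in> same_component (forest_of h)" if "root_of h x = root_of h y"
    unfolding same_component_def
    using root_reach[of x] symD[OF sym root_reach[of y]] unfolding that by (rule rtrancl_trans)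
qed

section \<open>Making the degrees equal\<close>

text \<open>Ranks list the elements of \<open>A\<close> in increasing order. Applied to a fibre,
  they number the siblings from 0 to \<open>d\<close>.\<close>

lemma bij_betw_rank:
  fixes A :: "nat set"
  assumes "finite A"
  shows "bij_betw (\<lambda>y. card {w. w < y \<and> w \<in> A}) A {..<card A}"
proof -
  let ?r = "\<lambda>y. card {w. w < y \<and> w \<in> A}"
  have fin: "finite {w. w < y \<and> w \<in> A}" for y using assms by simp
  have mono: "?r x < ?r y" if "x < y" "x \<in> A" for x y
    using that by (intro psubset_card_mono fin) auto
  have inj: "inj_on ?r A"
    by (rule linorder_inj_onI) (use mono in \<open>auto simp: neq_iff\<close>)
  have "?r y < card A" if "y \<in> A" for y
    using that by (intro psubset_card_mono assms) auto
  then have "?r ` A \<subseteq> {..<card A}" by auto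
  then have "?r ` A = {..<card A}"
    using card_image[OF inj] by (intro card_subset_eq) auto
  then show ?thesis using inj by (simp add: bij_betw_def)
qed

text \<open>A vertex that is not fixed has \<open>d + 1\<close> children: \<open>d - 1\<close> of them are kept, while
  the two smallest ones lose their parent and are joined to each other instead. A fixed
  point keeps its \<open>d\<close> children other than itself.\<close>

locale rooted_surjection =
  fixes g :: "nat \<Rightarrow> nat" and d :: nat
  assumes card_fibre: "card {y. g y = z} = Suc d"
    and reaches_fixpoint: "\<exists>n. g ((g ^^ n) y) = (g ^^ n) y"
    and d_pos: "0 < d"
begin

definition sibling_rank :: "nat \<Rightarrow> nat" where
  "sibling_rank y = card {w. w < y \<and> g w = g y}"

definition sibling0 :: "nat \<Rightarrow> nat" where
  "sibling0 y = (LEAST w. g w = g y)"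

text \<open>Of two abandoned siblings the one of rank 1 becomes a child of the one of rank 0. For
  the latter \<open>sibling0 y\<close> is \<open>y\<close> itself, which turns it into a new
  root.\<close>

definition new_parent :: "nat \<Rightarrow> nat" where
  "new_parent y = (if g y = y then y else if g (g y) = g y \<or> 2 \<le> sibling_rank y then g y
    else sibling0 y)"

definition depth :: "nat \<Rightarrow> nat" where
  "depth y = (LEAST n. g ((g ^^ n) y) = (g ^^ n) y)"

section \<open>Depths and ranks of siblings\<close>

lemma depth_Suc:
  assumes "g y \<noteq> y"
  shows "depth y = Suc (depth (g y))"
proof -
  obtain n where "g ((g ^^ n) y) = (g ^^ n) y" using reaches_fixpoint by blast
  then have "depth y = Suc (LEAST m. g ((g ^^ Suc m) y) = (g ^^ Suc m) y)"
    unfolding depth_def by (rule Least_Suc) (use assms in simp)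
  then show ?thesis by (simp add: depth_def funpow_swap1)
qed

lemma no_2_cycle: "g y \<noteq> y \<Longrightarrow> g (g y) \<noteq> y"
  using depth_Suc[of y] depth_Suc[of "g y"] by (cases "g (g y) = y") simp_all

lemma finite_fibre: "finite {y. g y = z}"
  using card_fibre[of z] by (intro card_ge_0_finite) simp

lemma bij_betw_sibling_rank: "bij_betw sibling_rank {y. g y = z} {..<Suc d}"
proof -
  have "bij_betw (\<lambda>y. card {w. w < y \<and> w \<in> {y. g y = z}}) {y. g y = z} {..<Suc d}"
    using bij_betw_rank[OF finite_fibre[of z]] card_fibre[of z] by simp
  then show ?thesis by (rule bij_betw_cong[THEN iffD1, rotated]) (simp add: sibling_rank_def)
qed

lemma sibling_rank_inj: "sibling_rank x = sibling_rank y \<Longrightarrow> g x = g y \<Longrightarrow> x = y"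
  using bij_betw_sibling_rank[of "g y"] unfolding bij_betw_def inj_on_def by blast

lemma sibling_rank_surj:
  assumes "i \<le> d"
  obtains y where "g y = z" "sibling_rank y = i"
proof -
  have "i \<in> sibling_rank ` {y. g y = z}"
    using bij_betw_sibling_rank[of z] assms by (simp add: bij_betw_def)
  then show thesis using that by auto
qed

lemma sibling0: "g (sibling0 y) = g y" "sibling_rank (sibling0 y) = 0"
proof -
  show g: "g (sibling0 y) = g y" unfolding sibling0_def by (rule LeastI) simp
  have "{w. w < sibling0 y \<and> g w = g (sibling0 y)} = {}"
    unfolding g unfolding sibling0_def by (auto dest: not_less_Least)
  then show "sibling_rank (sibling0 y) = 0" unfolding sibling_rank_def by simp
qed

lemma sibling0_eq: "g x = g y \<Longrightarrow> sibling_rank x = 0 \<Longrightarrow> sibling0 y = x"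
  using sibling0[of y] sibling_rank_inj[of "sibling0 y" x] by simp

lemma card_late_children: "card {y. g y = z \<and> 2 \<le> sibling_rank y} = d - 1"
proof -
  have "bij_betw sibling_rank {y. g y = z \<and> 2 \<le> sibling_rank y} {2..<Suc d}"
    unfolding bij_betw_def
  proof
    show "inj_on sibling_rank {y. g y = z \<and> 2 \<le> sibling_rank y}"
      by (rule inj_onI) (auto intro: sibling_rank_inj)
    have "sibling_rank ` {y. g y = z \<and> 2 \<le> sibling_rank y} = sibling_rank ` {y. g y = z} \<inter> {2..}"
      by auto
    also have "sibling_rank ` {y. g y = z} = {..<Suc d}"
      using bij_betw_sibling_rank by (simp add: bij_betw_def)
    finally show "sibling_rank ` {y. g y = z \<and> 2 \<le> sibling_rank y} = {2..<Suc d}"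
      by auto
  qed
  then show ?thesis by (simp add: bij_betw_same_card)
qed

text \<open>A step to \<open>g y\<close> lowers the depth. A step from rank 1 to rank 0 keeps the
  depth and lowers only the second term; doubling the depth lets a step of the first kind outweigh
  any change in that term.\<close>

lemma new_parent_decreasing:
  assumes "new_parent y \<noteq> y"
  shows "2 * depth (new_parent y) + min 1 (sibling_rank (new_parent y)) <
    2 * depth y + min 1 (sibling_rank y)"
proof -
  have y: "g y \<noteq> y" using assms by (auto simp: new_parent_def)
  show ?thesis
  proof (cases "g (g y) = g y \<or> 2 \<le> sibling_rank y")
    case True
    then show ?thesis using y depth_Suc[OF y] by (simp add: new_parent_def)
  next
    case False
    then have p: "new_parent y = sibling0 y" using y by (simp add: new_parent_def)
    then have "sibling_rank y \<noteq> 0" using assms sibling0_eq[of y y] by auto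
    moreover have "depth (sibling0 y) = depth y"
    proof -
      have "g (sibling0 y) \<noteq> sibling0 y" using False sibling0(1)[of y] by metis
      then show ?thesis using depth_Suc[OF y] depth_Suc[of "sibling0 y"] sibling0(1)[of y] by simp
    qed
    ultimately show ?thesis using p sibling0(2)[of y] by simp
  qed
qed

text \<open>A vertex that is not fixed has the \<open>d - 1\<close> children it keeps and exactly
  one further neighbour: its parent if the edge to it is kept, and otherwise the other abandoned
  sibling.\<close>

lemma card_neighbours:
  defines "N \<equiv> \<lambda>v. adjacency (forest_of new_parent) `` {v}"
  shows "finite (N v) \<and> card (N v) = d"
proof (cases "g v = v")
  case True
  have "N v = {u. g u = v} - {v}"
  proof (intro set_eqI iffI)
    fix u assume "u \<in> N v"
    then have u: "u \<noteq> v" "new_parent u = v"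
      using True by (auto simp: N_def adjacency_forest_of new_parent_def)
    have "g u = v"
    proof (rule ccontr)
      assume "g u \<noteq> v"
      then have "sibling0 u = v" "g (g u) \<noteq> g u"
        using u by (auto simp: new_parent_def split: if_splits)
      then show False using sibling0(1)[of u] True by simp
    qed
    then show "u \<in> {u. g u = v} - {v}" using u by simp
  next
    fix u assume "u \<in> {u. g u = v} - {v}"
    then show "u \<in> N v" using True by (auto simp: N_def adjacency_forest_of new_parent_def)
  qed
  then show ?thesis using card_fibre[of v] finite_fibre[of v] True by simp
next
  case False
  define C where "C = {u. g u = v \<and> 2 \<le> sibling_rank u}"
  have C: "finite C" "card C = d - 1"
    using finite_fibre[of v] card_late_children[of v] by (auto simp: C_def)
  have child: "u \<noteq> v \<and> new_parent u = v \<longleftrightarrow>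
    u \<in> C \<or> (g u = g v \<and> sibling_rank u = 1 \<and> sibling_rank v = 0 \<and> g (g v) \<noteq> g v)" for u
  proof
    assume u: "u \<noteq> v \<and> new_parent u = v"
    then have gu: "g u \<noteq> u" by (auto simp: new_parent_def)
    show "u \<in> C \<or> (g u = g v \<and> sibling_rank u = 1 \<and> sibling_rank v = 0 \<and> g (g v) \<noteq> g v)"
    proof (cases "g (g u) = g u \<or> 2 \<le> sibling_rank u")
      case True
      then show ?thesis using u gu False by (auto simp: new_parent_def C_def)
    next
      case early: False
      then have "sibling0 u = v" using u gu by (simp add: new_parent_def)
      then have v: "g v = g u" "sibling_rank v = 0" using sibling0[of u] by auto
      moreover have "sibling_rank u \<noteq> 0" using u v sibling_rank_inj[of u v] by auto
      ultimately show ?thesis using early by auto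
    qed
  next
    assume "u \<in> C \<or> (g u = g v \<and> sibling_rank u = 1 \<and> sibling_rank v = 0 \<and> g (g v) \<noteq> g v)"
    then show "u \<noteq> v \<and> new_parent u = v"
    proof
      assume "u \<in> C"
      then show ?thesis using False by (auto simp: C_def new_parent_def)
    next
      assume u: "g u = g v \<and> sibling_rank u = 1 \<and> sibling_rank v = 0 \<and> g (g v) \<noteq> g v"
      then have "g u \<noteq> u" by metis
      then have "new_parent u = sibling0 u" using u by (auto simp: new_parent_def)
      then show ?thesis using u sibling0_eq[of v u] by auto
    qed
  qed
  have N: "N v = {u. u \<noteq> v \<and> new_parent u = v} \<union> {u. u \<noteq> v \<and> new_parent v = u}"
    by (auto simp: N_def adjacency_forest_of)
  have "\<exists>p. N v = insert p C \<and> p \<notin> C"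
  proof (cases "g (g v) = g v \<or> 2 \<le> sibling_rank v")
    case True
    then have "new_parent v = g v" using False by (simp add: new_parent_def)
    then have "N v = insert (g v) C" unfolding N child using True False by auto
    moreover have "g v \<notin> C" using no_2_cycle[OF False] by (simp add: C_def)
    ultimately show ?thesis by blast
  next
    case early: False
    then have p: "new_parent v = sibling0 v" using False by (simp add: new_parent_def)
    show ?thesis
    proof (cases "sibling_rank v = 0")
      case True
      then have "new_parent v = v" using p sibling0_eq[of v v] by simp
      \<comment> \<open>A fibre has \<open>d + 1 \<ge> 2\<close> elements, so a sibling of rank 1
        exists.\<close>
      moreover obtain b where b: "g b = g v" "sibling_rank b = 1"
        using sibling_rank_surj[of 1 "g v"] d_pos by (metis One_nat_def Suc_leI)
      moreover have "u = b" if "g u = g v" "sibling_rank u = 1" for u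
        using that b sibling_rank_inj[of u b] by simp
      ultimately have "{u. u \<noteq> v \<and> new_parent u = v} = insert b C" "{u. u \<noteq> v \<and> new_parent v = u} = {}"
        unfolding child using True early b by blast+
      then have "N v = insert b C" unfolding N by blast
      moreover have "b \<notin> C" using b False by (simp add: C_def)
      ultimately show ?thesis by blast
    next
      case False
      then have "sibling0 v \<noteq> v" using sibling0(2)[of v] by auto
      then have "N v = insert (sibling0 v) C" unfolding N child p using False by auto
      moreover have "sibling0 v \<notin> C" using sibling0(2)[of v] by (simp add: C_def)
      ultimately show ?thesis by blast
    qed
  qed
  then obtain p where "N v = insert p C" "p \<notin> C" by blast
  then show ?thesis using C d_pos by simp
qed

lemma regular_forest_new_parent: "regular_forest d (forest_of new_parent)"
proof -
  have "\<not> cycle (forest_of new_parent) vs" for vs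
    by (rule acyclic_forest_of[where \<mu> = "\<lambda>y. 2 * depth y + min 1 (sibling_rank y)"])
      (rule new_parent_decreasing)
  then show ?thesis using card_neighbours by (simp add: regular_forest_def)
qed

lemma new_parent_reaches_fixpoint: "\<exists>n. new_parent ((new_parent ^^ n) y) = (new_parent ^^ n) y"
proof (induction "2 * depth y + min 1 (sibling_rank y)" arbitrary: y rule: less_induct)
  case less
  show ?case
  proof (cases "new_parent y = y")
    case True
    then show ?thesis by (intro exI[of _ 0]) simp
  next
    case False
    then obtain n where "new_parent ((new_parent ^^ n) (new_parent y)) = (new_parent ^^ n) (new_parent y)"
      using less new_parent_decreasing by blast
    then show ?thesis by (intro exI[of _ "Suc n"]) (simp add: funpow_swap1)
  qed
qed

section \<open>Computability of the forest and of its components\<close>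

lemma cmp_new_parent:
  assumes "computable_fun g"
  shows "cmp k a \<Longrightarrow> cmp k (\<lambda>xs. new_parent (a xs))"
proof (rule cmp_app1[of new_parent])
  have g: "cmp k (\<lambda>xs. g (a xs))" if "cmp k a" for k a
    using cmp_app1[of g] assms that by (simp add: computable_fun_iff_cmp)
  have "cmp 1 (\<lambda>xs. sibling0 (hd xs))"
    unfolding sibling0_def
  proof (rule cmp_Least)
    show "dec (Suc 1) (\<lambda>ys. g (hd ys) = g (hd (tl ys)))"
      by (intro cmp_intros g; simp)
  qed blast
  then show "cmp 1 (\<lambda>xs. new_parent (hd xs))"
    unfolding new_parent_def sibling_rank_def
    by (intro cmp_intros g; simp)
qed

lemma computable_forest:
  assumes "computable_fun g"
  shows "computable_rel (forest_of new_parent)"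
  unfolding computable_rel_iff_dec forest_of_def mem_Collect_eq prod.case
  by (intro cmp_intros cmp_new_parent[OF assms]; simp)

text \<open>Every orbit reaches a fixed point, so roots are found by search, and components are
  compared by their roots.\<close>

lemma computable_same_component:
  assumes "computable_fun g"
  shows "computable_rel (same_component (forest_of new_parent))"
proof -
  note np = cmp_new_parent[OF assms]
  have iter: "cmp k (\<lambda>xs. (new_parent ^^ a xs) (b xs))" if "cmp k a" "cmp k b" for k a b
    using that by (intro cmp_funpow np cmp_var0) auto
  have "cmp 1 (\<lambda>xs. LEAST n. new_parent ((new_parent ^^ n) (hd xs)) = (new_parent ^^ n) (hd xs))"
  proof (rule cmp_Least)
    show "dec (Suc 1) (\<lambda>ys. new_parent ((new_parent ^^ hd ys) (hd (tl ys))) = (new_parent ^^ hd ys) (hd (tl ys)))"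
      by (intro cmp_intros np iter; simp)
  qed (rule new_parent_reaches_fixpoint)
  then have "cmp 1 (\<lambda>xs. root_of new_parent (hd xs))"
    unfolding root_of_def by (intro iter cmp_var0) auto
  then have root: "cmp k (\<lambda>xs. root_of new_parent (a xs))" if "cmp k a" for k a
    using that by (rule cmp_app1[of "root_of new_parent"])
  show ?thesis
    unfolding computable_rel_iff_dec same_component_forest_of[OF new_parent_reaches_fixpoint]
    by (intro cmp_intros root; simp)
qed

text \<open>Two siblings are joined by a path of length two through their common parent; for the
  other edges reflexivity supplies the second step.\<close>

lemma forest_subset:
  assumes "\<And>y. (g y, y) \<in> E" "\<And>x. (x, x) \<in> E" "sym E"
  shows "forest_of new_parent \<subseteq> E O E"
proof
  fix e assume "e \<in> forest_of new_parent"
  then obtain y where e: "e = (new_parent y, y)" by (auto simp: forest_of_def)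
  have "(sibling0 y, g y) \<in> E" using assms(1)[of "sibling0 y"] assms(3) sibling0(1)[of y] by (metis symD)
  then show "e \<in> E O E" unfolding e new_parent_def using assms(1,2) by auto
qed

end

text \<open>The degree of \<open>n\<close> grows by one exactly when the loop at \<open>n\<close> is
  missing, which is decidable.\<close>

lemma highly_computable_reflcl:
  assumes "highly_computable E"
  shows "highly_computable (E \<union> Id)"
proof -
  have E: "dec k (\<lambda>xs. (a xs, b xs) \<in> E)" if "cmp k a" "cmp k b" for k a b
    using assms that cmp_app2[of "\<lambda>x y. of_bool ((x, y) \<in> E)" k a b]
    by (simp add: highly_computable_def computable_rel_iff_dec)
  have fin: "finite (E `` {n})" for n using assms by (simp add: highly_computable_def)
  have "cmp 1 (\<lambda>xs. card (E `` {hd xs}) + of_bool ((hd xs, hd xs) \<notin> E))"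
    using assms
    by (intro cmp_intros E) (auto simp: highly_computable_def computable_fun_iff_cmp)
  moreover have "card ((E \<union> Id) `` {n}) = card (E `` {n}) + of_bool ((n, n) \<notin> E)" for n
  proof -
    have "(E \<union> Id) `` {n} = insert n (E `` {n})" by blast
    then show ?thesis using fin[of n] by (simp add: card_insert_if)
  qed
  ultimately have "computable_fun (\<lambda>n. card ((E \<union> Id) `` {n}))"
    by (simp add: computable_fun_iff_cmp)
  moreover have "finite ((E \<union> Id) `` {n})" for n
  proof -
    have "(E \<union> Id) `` {n} = insert n (E `` {n})" by blast
    then show ?thesis using fin by simp
  qed
  moreover have "computable_rel (E \<union> Id)"
    unfolding computable_rel_iff_dec Un_iff pair_in_Id_conv by (intro cmp_intros E; simp)
  ultimately show ?thesis by (simp add: highly_computable_def)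
qed

theorem theorem1:
  fixes d :: nat and \<E> :: "(nat \<times> nat) set set"
  assumes "d \<ge> 3"
    and "bounded_geometry_coarse_space UNIV \<E>"
    and "\<not> amenable UNIV \<E>"
    and "\<exists>E\<in>\<E>. sym E \<and> highly_computable E \<and>
           (\<forall>F. finite F \<longrightarrow> card (E `` F) \<ge> (d + 2) * card F)"
  shows "\<exists>E'\<in>\<E>. computable_rel E' \<and> regular_forest d E' \<and>
           computable_rel (same_component E')"
proof -
  interpret bounded_geometry_coarse_space UNIV \<E> by (rule assms(2))
  from assms(4) obtain E0 where E0: "E0 \<in> \<E>" "sym E0" "highly_computable E0"
    "\<And>F. finite F \<Longrightarrow> (d + 2) * card F \<le> card (E0 `` F)" by blast
  define E where "E = E0 \<union> Id"
  have "Id_on UNIV = (Id :: (nat \<times> nat) set)" by auto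
  then have E: "E \<in> \<E>" unfolding E_def using union_closed[OF E0(1) diagonal] by simp
  \<comment> \<open>Fibres of size \<open>d + 1\<close> call for the expansion constant
    \<open>d + 2\<close>, which is the one assumed.\<close>
  interpret computable_expanding_relation E "Suc d"
  proof
    show fin: "finite (E `` {x})" for x using bounded_geometry[OF E] by simp
    show "(x, x) \<in> E" for x by (simp add: E_def)
    show "sym E" unfolding E_def using E0(2) by (intro sym_Un sym_Id)
    show "highly_computable E" unfolding E_def using E0(3) by (rule highly_computable_reflcl)
    show "Suc (Suc d) * card F \<le> card (E `` F)" if F: "finite F" for F
    proof -
      have "E `` F = (\<Union>x\<in>F. E `` {x})" by blast
      then have "finite (E `` F)" using F fin by simp
      then have "card (E0 `` F) \<le> card (E `` F)" by (rule card_mono) (auto simp: E_def)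
      then show ?thesis using E0(4)[OF F] by simp
    qed
  qed simp
  interpret rooted_surjection parent d
  proof
    show "card {y. parent y = z} = Suc d" for z by (rule card_parent_fibre)
    show "\<exists>n. parent ((parent ^^ n) y) = (parent ^^ n) y" for y by (rule parent_reaches_fixpoint)
    show "0 < d" using assms(1) by simp
  qed
  have "forest_of new_parent \<in> \<E>"
    using forest_subset[of E] parent_edge refl_E sym_E relcomp_closed[OF E E] subset_closed by metis
  then show ?thesis
    using computable_forest computable_same_component computable_parent regular_forest_new_parent
    by blast
qed

end
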